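(* Let $H$ be a complex Hilbert space, let $I\subseteq\mathbb{R}$ be an interval, let $f:I\to[0,\infty)$ be continuous, let $S\subseteq B(H)_{sa}$ be an open invex set with respect to a map $\eta:S\times S\to B(H)_{sa}$, and suppose that $\eta$ satisfies condition (C). Suppose that for every $A,B\in S$ such that the spectra of $A$ and $V:=A+\eta(B,A)$ are contained in $I$, the function $f$ is operator preinvex with respect to $\eta$ for operators in the $\eta$-path $P_{AV}$. Then for all such $A,B$, for every $a,b\in(0,1)$ with $a<b$ and every $x\in H$ with $\|x\|=1$, $$\left|\frac12\left\langle\int_0^a f(A+s\eta(B,A))\,ds\;x,x\right\rangle+\frac12\left\langle\int_0^b f(A+s\eta(B,A))\,ds\;x,x\right\rangle-\frac1{b-a}\int_a^b\left\langle\int_0^t f(A+s\eta(B,A))\,ds\;x,x\right\rangle dt\right|$$ $$\le\frac{b-a}{8}\left\{\langle f(A+a\eta(B,A))x,x\rangle+\langle f(A+b\eta(B,A))x,x\rangle\right\}.$$ Moreover, $$\left\|\frac12\int_0^a f(A+s\eta(B,A))\,ds+\frac12\int_0^b f(A+s\eta(B,A))\,ds-\frac1{b-a}\int_a^b\int_0^t f(A+s\eta(B,A))\,ds\,dt\right\|$$ $$\le\frac{b-a}{8}\left\|f(A+a\eta(B,A))+f(A+b\eta(B,A))\right\|\le\frac{b-a}{8}\left[\|f(A+a\eta(B,A))\|+\|f(A+b\eta(B,A))\|\right].$$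
   Context: $B(H)$ is the algebra of bounded linear operators on $H$ and $B(H)_{sa}$ the real vector space of bounded selfadjoint operators (with the operator norm). For selfadjoint $A,B$, $A\le B$ means $\langle Ax,x\rangle\le\langle Bx,x\rangle$ for all $x\in H$ (operator order). For selfadjoint $A$ and $f$ continuous on the spectrum of $A$, $f(A)$ is given by the continuous functional calculus. Operator-valued integrals are norm (Riemann) integrals of continuous functions. Invex set: $S$ is invex with respect to $\eta:S\times S\to B(H)_{sa}$ if $Y+t\eta(X,Y)\in S$ for all $X,Y\in S$ and $t\in[0,1]$. Condition (C): for all $X,Y\in S$ and $t\in[0,1]$, $\eta(Y,Y+t\eta(X,Y))=-t\,\eta(X,Y)$ and $\eta(X,Y+t\eta(X,Y))=(1-t)\,\eta(X,Y)$. $\eta$-path: for $A,B\in S$ and $V=A+\eta(B,A)$, $P_{AV}=\{A+t\eta(B,A):t\in[0,1]\}$. Operator preinvex: $f$ is operator preinvex on $I$ with respect to $\eta$ for operators in a set $T\subseteq S$ if $f(Y+t\eta(X,Y))\le(1-t)f(Y)+tf(X)$ in the operator order, for all $t\in[0,1]$ and all $X,Y\in T$ whose spectra are contained in $I$. *)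

theory Defs
  imports "HOL-Analysis.Analysis"
begin

(* The norm and the real scalar multiplication inherited from banach are tied to the
   complex structure by the last two axioms.  cinner is linear in its first argument. *)
class complex_hilbert_space = banach +
  fixes scaleC :: "complex \<Rightarrow> 'a \<Rightarrow> 'a" (infixr "*\<^sub>C" 75)
    and cinner :: "'a \<Rightarrow> 'a \<Rightarrow> complex"
  assumes scaleC_add_right: "c *\<^sub>C (x + y) = c *\<^sub>C x + c *\<^sub>C y"
    and scaleC_add_left: "(c + d) *\<^sub>C x = c *\<^sub>C x + d *\<^sub>C x"
    and scaleC_scaleC: "c *\<^sub>C (d *\<^sub>C x) = (c * d) *\<^sub>C x"
    and scaleC_one: "1 *\<^sub>C x = x"
    and cinner_add_left: "cinner (x + y) z = cinner x z + cinner y z"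
    and cinner_scaleC_left: "cinner (c *\<^sub>C x) y = c * cinner x y"
    and cinner_commute: "cinner x y = cnj (cinner y x)"
    and cinner_ge_zero: "0 \<le> Re (cinner x x)"
    and cinner_eq_zero_iff: "cinner x x = 0 \<longleftrightarrow> x = 0"
    and scaleR_scaleC: "r *\<^sub>R x = complex_of_real r *\<^sub>C x"
    and norm_eq_sqrt_cinner: "norm x = sqrt (Re (cinner x x))"

(* The library type of bounded linear maps consists of the real-linear ones; B(H) is its
   subset of complex-linear maps.  The library norm is the operator norm. *)
definition bounded_ops :: "('a::complex_hilbert_space \<Rightarrow>\<^sub>L 'a) set"
  where "bounded_ops =
    {A. \<forall>c x. blinfun_apply A (c *\<^sub>C x) = c *\<^sub>C blinfun_apply A x}"

definition is_adjoint ::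
    "('a::complex_hilbert_space \<Rightarrow>\<^sub>L 'a) \<Rightarrow> ('a \<Rightarrow>\<^sub>L 'a) \<Rightarrow> bool"
  where "is_adjoint A B \<longleftrightarrow>
    (\<forall>x y. cinner (blinfun_apply A x) y = cinner x (blinfun_apply B y))"

definition selfadjoint_ops :: "('a::complex_hilbert_space \<Rightarrow>\<^sub>L 'a) set"
  where "selfadjoint_ops = {A \<in> bounded_ops. is_adjoint A A}"

(* For selfadjoint operators both inner products are real, so Re loses nothing. *)
definition op_le ::
    "('a::complex_hilbert_space \<Rightarrow>\<^sub>L 'a) \<Rightarrow> ('a \<Rightarrow>\<^sub>L 'a) \<Rightarrow> bool"
  where "op_le A B \<longleftrightarrow>
    (\<forall>x. Re (cinner (blinfun_apply A x) x) \<le> Re (cinner (blinfun_apply B x) x))"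

definition op_spectrum :: "('a::complex_hilbert_space \<Rightarrow>\<^sub>L 'a) \<Rightarrow> complex set"
  where "op_spectrum A =
    {z. \<not> (\<exists>B \<in> bounded_ops. \<forall>x.
          blinfun_apply B (blinfun_apply A x - z *\<^sub>C x) = x \<and>
          blinfun_apply A (blinfun_apply B x) - z *\<^sub>C blinfun_apply B x = x)}"

(* Phi is the isometric unital *-homomorphism from C(spectrum of A) into B(H) sending the
   identity function to A.  Phi takes total functions, but is constrained only on those
   continuous on the spectrum; the isometry clause makes its value depend only on the
   restriction to the spectrum.  That clause states norm (Phi g) = sup |g| in a form that
   is also correct for the empty spectrum, i.e. H = {0}. *)
definition is_continuous_calculus ::
    "('a::complex_hilbert_space \<Rightarrow>\<^sub>L 'a) \<Rightarrow>
     ((complex \<Rightarrow> complex) \<Rightarrow> ('a \<Rightarrow>\<^sub>L 'a)) \<Rightarrow> bool"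
  where "is_continuous_calculus A \<Phi> \<longleftrightarrow>
    (\<forall>g. continuous_on (op_spectrum A) g \<longrightarrow>
       \<Phi> g \<in> bounded_ops \<and>
       (\<forall>c x. blinfun_apply (\<Phi> (\<lambda>z. c * g z)) x = c *\<^sub>C blinfun_apply (\<Phi> g) x) \<and>
       is_adjoint (\<Phi> g) (\<Phi> (\<lambda>z. cnj (g z))) \<and>
       (\<forall>r\<ge>0. norm (\<Phi> g) \<le> r \<longleftrightarrow> (\<forall>z\<in>op_spectrum A. cmod (g z) \<le> r))) \<and>
    (\<forall>g h. continuous_on (op_spectrum A) g \<longrightarrow> continuous_on (op_spectrum A) h \<longrightarrow>
       \<Phi> (\<lambda>z. g z + h z) = \<Phi> g + \<Phi> h \<and>
       \<Phi> (\<lambda>z. g z * h z) = \<Phi> g o\<^sub>L \<Phi> h) \<and>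
    \<Phi> (\<lambda>z. 1) = id_blinfun \<and>
    \<Phi> (\<lambda>z. z) = A"

(* f(A) for selfadjoint A, whose spectrum is real; meaningful when f is continuous on it. *)
definition op_fun ::
    "(real \<Rightarrow> real) \<Rightarrow> ('a::complex_hilbert_space \<Rightarrow>\<^sub>L 'a) \<Rightarrow> ('a \<Rightarrow>\<^sub>L 'a)"
  where "op_fun f A =
    (THE T. \<exists>\<Phi>. is_continuous_calculus A \<Phi> \<and> T = \<Phi> (\<lambda>z. complex_of_real (f (Re z))))"

definition spectrum_in ::
    "('a::complex_hilbert_space \<Rightarrow>\<^sub>L 'a) \<Rightarrow> real set \<Rightarrow> bool"
  where "spectrum_in A I \<longleftrightarrow> op_spectrum A \<subseteq> complex_of_real ` I"

definition invex_set ::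
    "('a::complex_hilbert_space \<Rightarrow>\<^sub>L 'a) set \<Rightarrow>
     (('a \<Rightarrow>\<^sub>L 'a) \<Rightarrow> ('a \<Rightarrow>\<^sub>L 'a) \<Rightarrow> ('a \<Rightarrow>\<^sub>L 'a)) \<Rightarrow> bool"
  where "invex_set S \<eta> \<longleftrightarrow>
    (\<forall>X\<in>S. \<forall>Y\<in>S. \<forall>t\<in>{0..1}. Y + t *\<^sub>R \<eta> X Y \<in> S)"

definition condition_C ::
    "('a::complex_hilbert_space \<Rightarrow>\<^sub>L 'a) set \<Rightarrow>
     (('a \<Rightarrow>\<^sub>L 'a) \<Rightarrow> ('a \<Rightarrow>\<^sub>L 'a) \<Rightarrow> ('a \<Rightarrow>\<^sub>L 'a)) \<Rightarrow> bool"
  where "condition_C S \<eta> \<longleftrightarrow>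
    (\<forall>X\<in>S. \<forall>Y\<in>S. \<forall>t\<in>{0..1}.
       \<eta> Y (Y + t *\<^sub>R \<eta> X Y) = - (t *\<^sub>R \<eta> X Y) \<and>
       \<eta> X (Y + t *\<^sub>R \<eta> X Y) = (1 - t) *\<^sub>R \<eta> X Y)"

(* The path from A to V = A + eta B A; it depends on B, not only on the end point V. *)
definition eta_path ::
    "(('a::complex_hilbert_space \<Rightarrow>\<^sub>L 'a) \<Rightarrow> ('a \<Rightarrow>\<^sub>L 'a) \<Rightarrow> ('a \<Rightarrow>\<^sub>L 'a)) \<Rightarrow>
     ('a \<Rightarrow>\<^sub>L 'a) \<Rightarrow> ('a \<Rightarrow>\<^sub>L 'a) \<Rightarrow> ('a \<Rightarrow>\<^sub>L 'a) set"
  where "eta_path \<eta> A B = {A + t *\<^sub>R \<eta> B A | t. t \<in> {0..1}}"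

definition operator_preinvex ::
    "real set \<Rightarrow>
     (('a::complex_hilbert_space \<Rightarrow>\<^sub>L 'a) \<Rightarrow> ('a \<Rightarrow>\<^sub>L 'a) \<Rightarrow> ('a \<Rightarrow>\<^sub>L 'a)) \<Rightarrow>
     ('a \<Rightarrow>\<^sub>L 'a) set \<Rightarrow> (real \<Rightarrow> real) \<Rightarrow> bool"
  where "operator_preinvex I \<eta> T f \<longleftrightarrow>
    (\<forall>X\<in>T. \<forall>Y\<in>T. spectrum_in X I \<longrightarrow> spectrum_in Y I \<longrightarrow>
       (\<forall>t\<in>{0..1}. op_le (op_fun f (Y + t *\<^sub>R \<eta> X Y))
                           ((1 - t) *\<^sub>R op_fun f Y + t *\<^sub>R op_fun f X)))"

end

theory Submission
  imports Defs "HOL-Computational_Algebra.Fundamental_Theorem_Algebra"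
begin

text \<open>
  Put \<open>D = \<eta> B A\<close> and \<open>\<phi> s = f (A + s D)\<close>. Condition (C) gives
  \<open>\<eta> (A + a D) (A + b D) = (a - b) D\<close>, so preinvexity says that \<open>\<phi>\<close> lies below its chord
  on \<open>[a, b]\<close>. For a fixed vector \<open>x\<close>, integration by parts turns the trapezoid error of
  \<open>t \<mapsto> \<integral>\<^sub>0\<^sup>t \<langle>\<phi> s x, x\<rangle> ds\<close> into \<open>(b - a)\<inverse> \<integral> (t - c) \<langle>\<phi> t x, x\<rangle> dt\<close> with \<open>c\<close> the midpoint;
  replacing the nonnegative integrand by its chord gives the first bound. The error operator is
  selfadjoint, so its norm is its numerical radius, which gives the second bound.

  For this \<open>f (A + s D)\<close> has to exist, to be selfadjoint and positive, and to be norm-continuous in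
  \<open>s\<close>. For selfadjoint \<open>A\<close> a point \<open>z\<close> is outside the spectrum iff \<open>A - z\<close> is bounded
  below. If \<open>T = p(A)\<close> and \<open>N = \<parallel>T\<parallel>\<close>, then \<open>T\<^sup>* T - N\<^sup>2\<close> is not bounded below; factoring the
  polynomial \<open>cnj p \<cdot> p - N\<^sup>2\<close> over the complex numbers yields a spectral point \<open>z\<close> of \<open>A\<close> with
  \<open>|p z| = N\<close>. Hence \<open>p \<mapsto> p(A)\<close> is isometric for the supremum norm on the spectrum, and
  Stone-Weierstrass extends it to continuous functions.
\<close>

section \<open>Complex inner products and selfadjoint operators\<close>

lemma cinner_add_right: "cinner x (y + z) = cinner x y + cinner x z"
  for x y z :: "'a::complex_hilbert_space"
  by (metis cinner_add_left cinner_commute complex_cnj_add)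

lemma cinner_scaleC_right: "cinner x (c *\<^sub>C y) = cnj c * cinner x y"
  for x y :: "'a::complex_hilbert_space"
  by (metis cinner_commute cinner_scaleC_left complex_cnj_mult)

lemma cinner_self: "cinner x x = complex_of_real ((norm x)\<^sup>2)"
  for x :: "'a::complex_hilbert_space"
proof -
  have "Im (cinner x x) = 0"
    using arg_cong[OF cinner_commute[of x x], of Im] by simp
  then show ?thesis
    by (simp add: complex_eq_iff norm_eq_sqrt_cinner cinner_ge_zero)
qed

lemma scaleR_scaleC_commute: "c *\<^sub>C (r *\<^sub>R x) = r *\<^sub>R (c *\<^sub>C x)"
  for x :: "'a::complex_hilbert_space"
  by (simp add: scaleR_scaleC scaleC_scaleC mult.commute)

lemma norm_scaleC: "norm (c *\<^sub>C x) = cmod c * norm x"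
  for x :: "'a::complex_hilbert_space"
proof -
  have "cinner (c *\<^sub>C x) (c *\<^sub>C x) = (c * cnj c) * cinner x x"
    by (simp add: cinner_scaleC_left cinner_scaleC_right)
  then have "(norm (c *\<^sub>C x))\<^sup>2 = (cmod c * norm x)\<^sup>2"
    unfolding cinner_self complex_norm_square[symmetric] of_real_mult[symmetric] of_real_eq_iff
    by (simp add: power_mult_distrib)
  then show ?thesis
    by (metis norm_ge_zero power2_eq_imp_eq mult_nonneg_nonneg)
qed

lemma cinner_minus_left: "cinner (- x) y = - cinner x y"
  for x :: "'a::complex_hilbert_space"
  using cinner_scaleC_left[of "-1" x y] scaleR_scaleC[of "-1" x] by simp

lemma cinner_minus_right: "cinner x (- y) = - cinner x y"
  for x :: "'a::complex_hilbert_space"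
  using cinner_scaleC_right[of x "-1" y] scaleR_scaleC[of "-1" y] by simp

lemma cinner_diff_left: "cinner (x - y) z = cinner x z - cinner y z"
  for x :: "'a::complex_hilbert_space"
  using cinner_add_left[of x "- y" z] by (simp add: cinner_minus_left)

lemma cinner_diff_right: "cinner z (x - y) = cinner z x - cinner z y"
  for x :: "'a::complex_hilbert_space"
  using cinner_add_right[of z x "- y"] by (simp add: cinner_minus_right)

lemma cinner_scaleR_left: "cinner (r *\<^sub>R x) y = complex_of_real r * cinner x y"
  for x :: "'a::complex_hilbert_space"
  by (simp add: scaleR_scaleC cinner_scaleC_left)

lemma cinner_scaleR_right: "cinner x (r *\<^sub>R y) = complex_of_real r * cinner x y"
  for x :: "'a::complex_hilbert_space"
  by (simp add: scaleR_scaleC cinner_scaleC_right)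

lemma norm_diff_square:
  "(norm (x - y))\<^sup>2 = (norm x)\<^sup>2 - 2 * Re (cinner x y) + (norm y)\<^sup>2"
  for x :: "'a::complex_hilbert_space"
proof -
  have "Re (cinner y x) = Re (cinner x y)"
    by (metis cinner_commute cnj.simps(1))
  then have "Re (cinner (x - y) (x - y)) = Re (cinner x x) - 2 * Re (cinner x y) + Re (cinner y y)"
    by (simp add: cinner_diff_left cinner_diff_right)
  then show ?thesis by (simp add: cinner_self)
qed

text \<open>Cauchy-Schwarz, from the nonnegativity of the squared distance between \<open>x\<close>
  and its orthogonal projection \<open>c *\<^sub>C y\<close> onto the line of
  \<open>y\<close>.\<close>

lemma cmod_cinner_le: "cmod (cinner x y) \<le> norm x * norm y"
  for x y :: "'a::complex_hilbert_space"
proof (cases "y = 0")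
  case True
  then show ?thesis using cinner_scaleR_right[of x 0 0] by simp
next
  case False
  define w where "w = cinner x y"
  define n where "n = (norm y)\<^sup>2"
  have n: "n > 0" using False by (simp add: n_def)
  define c where "c = w / complex_of_real n"
  have "Re (cinner x (c *\<^sub>C y)) = (cmod w)\<^sup>2 / n"
  proof -
    have "cinner x (c *\<^sub>C y) = (w * cnj w) / complex_of_real n"
      by (simp add: cinner_scaleC_right c_def w_def)
    also have "\<dots> = complex_of_real ((cmod w)\<^sup>2 / n)"
      by (simp add: complex_norm_square[symmetric])
    finally show ?thesis by simp
  qed
  moreover have "(norm (c *\<^sub>C y))\<^sup>2 = (cmod w)\<^sup>2 / n"
    unfolding norm_scaleC power_mult_distrib n_def[symmetric]
    using n by (simp add: c_def norm_divide power_divide power2_eq_square)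
  ultimately have "0 \<le> (norm x)\<^sup>2 - (cmod w)\<^sup>2 / n"
    using norm_diff_square[of x "c *\<^sub>C y"] zero_le_power2[of "norm (x - c *\<^sub>C y)"] by simp
  then have "(cmod w)\<^sup>2 \<le> (norm x * norm y)\<^sup>2"
    using n by (simp add: field_simps n_def power_mult_distrib)
  then show ?thesis
    unfolding w_def by (rule power2_le_imp_le) simp
qed

section \<open>Inner product and complex scaling as bounded bilinear maps\<close>

lemma bounded_bilinear_cinner:
  "bounded_bilinear (cinner :: 'a::complex_hilbert_space \<Rightarrow> 'a \<Rightarrow> complex)"
proof
  show "\<exists>K. \<forall>a b :: 'a. norm (cinner a b) \<le> norm a * norm b * K"
    by (rule exI[of _ 1]) (simp add: cmod_cinner_le)
qed (simp_all add: cinner_add_left cinner_add_right cinner_scaleR_left cinner_scaleR_right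
      scaleR_conv_of_real)

lemma bounded_bilinear_scaleC:
  "bounded_bilinear (scaleC :: complex \<Rightarrow> 'a::complex_hilbert_space \<Rightarrow> 'a)"
proof
  show "\<exists>K. \<forall>a. \<forall>b :: 'a. norm (a *\<^sub>C b) \<le> norm a * norm b * K"
    by (rule exI[of _ 1]) (simp add: norm_scaleC)
qed (simp_all add: scaleC_add_left scaleC_add_right scaleR_scaleC scaleC_scaleC
      scaleR_conv_of_real mult.commute)

lemma cinner_zero [simp]: "cinner 0 x = 0" "cinner x 0 = 0"
  for x :: "'a::complex_hilbert_space"
  by (simp_all add: bounded_bilinear.zero_left[OF bounded_bilinear_cinner]
      bounded_bilinear.zero_right[OF bounded_bilinear_cinner])

lemma scaleC_zero [simp]: "0 *\<^sub>C x = 0" "c *\<^sub>C 0 = 0"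
  for x :: "'a::complex_hilbert_space"
  by (simp_all add: bounded_bilinear.zero_left[OF bounded_bilinear_scaleC]
      bounded_bilinear.zero_right[OF bounded_bilinear_scaleC])

lemma selfadjointD:
  assumes "A \<in> selfadjoint_ops"
  shows "blinfun_apply A (c *\<^sub>C x) = c *\<^sub>C blinfun_apply A x"
    and "cinner (blinfun_apply A x) y = cinner x (blinfun_apply A y)"
    and "A \<in> bounded_ops"
  using assms by (auto simp: selfadjoint_ops_def bounded_ops_def is_adjoint_def)

lemma cinner_selfadjoint_real:
  assumes "A \<in> selfadjoint_ops"
  shows "cinner (blinfun_apply A x) x = complex_of_real (Re (cinner (blinfun_apply A x) x))"
proof -
  have "cnj (cinner (blinfun_apply A x) x) = cinner (blinfun_apply A x) x"
    by (metis assms cinner_commute selfadjointD(2))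
  then show ?thesis
    by (simp add: complex_eq_iff)
qed

lemma selfadjoint_ops_add:
  assumes "A \<in> selfadjoint_ops" "B \<in> selfadjoint_ops"
  shows "A + B \<in> selfadjoint_ops"
  using assms
  by (auto simp: selfadjoint_ops_def bounded_ops_def is_adjoint_def blinfun.add_left
      scaleC_add_right cinner_add_left cinner_add_right)

lemma selfadjoint_ops_scaleR:
  assumes "A \<in> selfadjoint_ops"
  shows "r *\<^sub>R A \<in> selfadjoint_ops"
  using assms
  by (auto simp: selfadjoint_ops_def bounded_ops_def is_adjoint_def blinfun.scaleR_left
      scaleR_scaleC_commute cinner_scaleR_left cinner_scaleR_right)

text \<open>For selfadjoint \<open>A\<close> this replaces invertibility of \<open>A - z\<close>.
  Being an inequality, it passes to products and small perturbations without constructing an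
  inverse.\<close>

definition bounded_below :: "('a::real_normed_vector \<Rightarrow>\<^sub>L 'a) \<Rightarrow> bool"
  where "bounded_below T \<longleftrightarrow> (\<exists>c>0. \<forall>x. c * norm x \<le> norm (blinfun_apply T x))"

lemma bounded_below_compose:
  assumes "bounded_below S" "bounded_below T"
  shows "bounded_below (S o\<^sub>L T)"
proof -
  obtain c d where "c > 0" and c: "\<And>x. c * norm x \<le> norm (blinfun_apply S x)"
    and "d > 0" and d: "\<And>x. d * norm x \<le> norm (blinfun_apply T x)"
    using assms by (auto simp: bounded_below_def)
  have "c * d * norm x \<le> norm (blinfun_apply (S o\<^sub>L T) x)" for x
    using order_trans[OF mult_left_mono[OF d[of x], of c] c[of "blinfun_apply T x"]] \<open>c > 0\<close>
    by (simp add: mult.assoc)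
  then show ?thesis
    unfolding bounded_below_def using \<open>c > 0\<close> \<open>d > 0\<close> by (intro exI[of _ "c * d"]) simp
qed

lemma bounded_below_perturb:
  assumes "c * norm x \<le> norm (blinfun_apply T x)"
  shows "(c - norm U) * norm x \<le> norm (blinfun_apply (T - U) x)"
  using assms norm_blinfun[of U x] norm_triangle_ineq2[of "blinfun_apply T x" "blinfun_apply U x"]
  by (simp add: blinfun.diff_left algebra_simps)

text \<open>For small \<open>t > 0\<close> the map \<open>x \<mapsto> x - t (P x - y)\<close> is a contraction.\<close>

lemma coercive_surj:
  fixes P :: "'a::complex_hilbert_space \<Rightarrow>\<^sub>L 'a"
  assumes k: "k > 0" and P: "\<And>x. k * (norm x)\<^sup>2 \<le> Re (cinner (blinfun_apply P x) x)"
  shows "surj (blinfun_apply P)"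
proof -
  \<comment> \<open>Adding \<open>k\<close> makes \<open>N\<close> positive and at least
    \<open>k\<close>, so that the square root in \<open>c\<close> is taken of a nonnegative
    number.\<close>
  define N where "N = norm P + k"
  have N: "N > 0" "norm P \<le> N" "k \<le> N" using k by (auto simp: N_def add_nonneg_pos)
  \<comment> \<open>This choice minimises \<open>1 - 2 * t * k + t\<^sup>2 * N\<^sup>2\<close>,
    which bounds the squared contraction factor; the minimum is
    \<open>1 - k\<^sup>2 / N\<^sup>2\<close>.\<close>
  define t where "t = k / N\<^sup>2"
  have t: "t > 0" using k N by (simp add: t_def)
  define c where "c = sqrt (1 - k\<^sup>2 / N\<^sup>2)"
  have "k\<^sup>2 / N\<^sup>2 \<le> 1" using k N by (simp add: field_simps)
  then have c0: "0 \<le> c" by (simp add: c_def)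
  have c1: "c < 1" using k N by (simp add: c_def)
  have csq: "c\<^sup>2 = 1 - k\<^sup>2 / N\<^sup>2" using \<open>k\<^sup>2 / N\<^sup>2 \<le> 1\<close> by (simp add: c_def)
  have contr: "norm (x - t *\<^sub>R blinfun_apply P x) \<le> c * norm x" for x
  proof (rule power2_le_imp_le)
    have "norm (blinfun_apply P x) \<le> N * norm x"
      using norm_blinfun[of P x] mult_right_mono[OF N(2), of "norm x"] by simp
    then have "(norm (blinfun_apply P x))\<^sup>2 \<le> N\<^sup>2 * (norm x)\<^sup>2"
      by (metis norm_ge_zero power_mono power_mult_distrib)
    then have "t\<^sup>2 * (norm (blinfun_apply P x))\<^sup>2 \<le> t\<^sup>2 * (N\<^sup>2 * (norm x)\<^sup>2)"
      by (rule mult_left_mono) simp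
    also have "\<dots> = k\<^sup>2 / N\<^sup>2 * (norm x)\<^sup>2"
      using N by (simp add: t_def power2_eq_square)
    finally have 1: "t\<^sup>2 * (norm (blinfun_apply P x))\<^sup>2 \<le> k\<^sup>2 / N\<^sup>2 * (norm x)\<^sup>2" .
    have "t * (k * (norm x)\<^sup>2) \<le> t * Re (cinner (blinfun_apply P x) x)"
      using P[of x] t by (intro mult_left_mono) auto
    then have 2: "k\<^sup>2 / N\<^sup>2 * (norm x)\<^sup>2 \<le> t * Re (cinner (blinfun_apply P x) x)"
      by (simp add: t_def power2_eq_square)
    have 3: "Re (cinner x (blinfun_apply P x)) = Re (cinner (blinfun_apply P x) x)"
      by (metis cinner_commute cnj.simps(1))
    have "(norm (x - t *\<^sub>R blinfun_apply P x))\<^sup>2 =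
        (norm x)\<^sup>2 - 2 * (t * Re (cinner (blinfun_apply P x) x)) + t\<^sup>2 * (norm (blinfun_apply P x))\<^sup>2"
      by (simp add: norm_diff_square cinner_scaleR_right 3 power_mult_distrib)
    also have "\<dots> \<le> (c * norm x)\<^sup>2"
      using 1 2 by (simp add: power_mult_distrib csq algebra_simps)
    finally show "(norm (x - t *\<^sub>R blinfun_apply P x))\<^sup>2 \<le> (c * norm x)\<^sup>2" .
  qed (use c0 in simp)
  show ?thesis
    unfolding surj_def
  proof
    fix y
    define F where "F x = (x - t *\<^sub>R blinfun_apply P x) + t *\<^sub>R y" for x
    have "dist (F u) (F v) \<le> c * dist u v" for u v
    proof -
      have "F u - F v = (u - v) - t *\<^sub>R blinfun_apply P (u - v)"
        by (simp add: F_def blinfun.diff_right scaleR_diff_right)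
      then show ?thesis using contr[of "u - v"] by (simp add: dist_norm)
    qed
    then have "\<exists>!x. F x = x"
      using c0 c1 by (intro banach_fix_type) auto
    then obtain x where "F x = x" by blast
    then have "t *\<^sub>R (y - blinfun_apply P x) = 0"
      by (simp add: F_def scaleR_diff_right algebra_simps)
    then show "\<exists>x. y = blinfun_apply P x" using t by auto
  qed
qed

section \<open>Polynomials in a selfadjoint operator and its spectrum\<close>

definition scaleC_op :: "complex \<Rightarrow> 'a::complex_hilbert_space \<Rightarrow>\<^sub>L 'a"
  where "scaleC_op c = Blinfun (\<lambda>x. c *\<^sub>C x)"

lemma scaleC_op_apply [simp]: "blinfun_apply (scaleC_op c) x = c *\<^sub>C x"
  unfolding scaleC_op_def
  by (subst bounded_linear_Blinfun_apply)
    (simp_all add: bounded_bilinear.bounded_linear_right[OF bounded_bilinear_scaleC])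

text \<open>Horner's scheme for evaluating a complex polynomial at an operator.\<close>

definition opoly :: "('a::complex_hilbert_space \<Rightarrow>\<^sub>L 'a) \<Rightarrow> complex poly \<Rightarrow> ('a \<Rightarrow>\<^sub>L 'a)"
  where "opoly A p = fold_coeffs (\<lambda>c T. scaleC_op c + (A o\<^sub>L T)) p 0"

lemma opoly_0 [simp]: "opoly A 0 = 0"
  by (simp add: opoly_def)

lemma opoly_pCons_apply:
  "blinfun_apply (opoly A (pCons c p)) x =
    c *\<^sub>C x + blinfun_apply A (blinfun_apply (opoly A p) x)"
  \<comment> \<open>\<open>fold_coeffs\<close> drops a coefficient only when the whole polynomial is
    zero, and then both sides vanish.\<close>
  by (cases "p = 0 \<and> c = 0") (auto simp add: opoly_def blinfun.add_left)

lemma opoly_pCons: "opoly A (pCons c p) = scaleC_op c + (A o\<^sub>L opoly A p)"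
  by (rule blinfun_eqI) (simp add: opoly_pCons_apply blinfun.add_left)

lemma opoly_add: "opoly A (p + q) = opoly A p + opoly A q"
  by (induction p q rule: poly_induct2)
    (auto intro!: blinfun_eqI simp: opoly_pCons_apply blinfun.add_left blinfun.add_right scaleC_add_left)

lemma opoly_1: "opoly A 1 = id_blinfun"
  by (rule blinfun_eqI) (simp add: one_pCons opoly_pCons_apply scaleC_one)

lemma opoly_X: "opoly A [:0, 1:] = A"
  by (rule blinfun_eqI) (simp add: opoly_pCons_apply scaleC_one blinfun.add_right)

lemma opoly_smult:
  assumes "A \<in> bounded_ops"
  shows "opoly A (smult c p) = scaleC_op c o\<^sub>L opoly A p"
proof (induction p)
  case 0
  then show ?case by (auto intro: blinfun_eqI)
next
  case (pCons a p)
  then show ?case using assms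
    by (auto intro!: blinfun_eqI simp: opoly_pCons_apply bounded_ops_def scaleC_add_right scaleC_scaleC)
qed

lemma opoly_mult:
  assumes "A \<in> bounded_ops"
  shows "opoly A (p * q) = opoly A p o\<^sub>L opoly A q"
proof (induction p)
  case 0
  then show ?case by (auto intro: blinfun_eqI)
next
  case (pCons a p)
  then show ?case using assms
    by (auto intro!: blinfun_eqI simp: opoly_pCons_apply opoly_add opoly_smult blinfun.add_left)
qed

lemma opoly_uminus: "A \<in> bounded_ops \<Longrightarrow> opoly A (- p) = - opoly A p"
  by (metis add_eq_0_iff opoly_0 opoly_add right_minus)

lemma opoly_diff: "A \<in> bounded_ops \<Longrightarrow> opoly A (p - q) = opoly A p - opoly A q"
  using opoly_add[of A p "- q"] by (simp add: opoly_uminus)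

lemma opoly_in_bounded_ops:
  assumes "A \<in> bounded_ops"
  shows "opoly A p \<in> bounded_ops"
proof (induction p)
  case 0
  then show ?case by (simp add: bounded_ops_def)
next
  case (pCons a p)
  then show ?case using assms
    by (auto simp: bounded_ops_def opoly_pCons_apply scaleC_add_right scaleC_scaleC mult.commute)
qed

text \<open>Since \<open>A\<close> is its own adjoint, only the coefficients get conjugated. Moving
  \<open>A\<close> across the inner product puts it on the wrong side of the remaining polynomial,
  which \<open>comm\<close> repairs.\<close>

lemma opoly_adjoint:
  assumes A: "A \<in> selfadjoint_ops"
  shows "cinner (blinfun_apply (opoly A p) x) y = cinner x (blinfun_apply (opoly A (map_poly cnj p)) y)"
proof (induction p arbitrary: x y)
  case 0
  then show ?case by simp
next
  case (pCons a p)
  have comm: "blinfun_apply A (blinfun_apply (opoly A q) y) = blinfun_apply (opoly A q) (blinfun_apply A y)" for q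
    using opoly_mult[OF selfadjointD(3)[OF A], of "[:0, 1:]" q]
      opoly_mult[OF selfadjointD(3)[OF A], of q "[:0, 1:]"]
    by (simp only: opoly_X mult.commute[of q] blinfun_apply_blinfun_compose[symmetric])
  show ?case
    by (simp add: opoly_pCons_apply map_poly_pCons cinner_add_left cinner_add_right
        cinner_scaleC_left cinner_scaleC_right selfadjointD(2)[OF A] pCons.IH comm)
qed

lemma opoly_linear_apply: "blinfun_apply (opoly A [:- z, 1:]) x = blinfun_apply A x - z *\<^sub>C x"
  using scaleC_add_left[of z "- z" x]
  by (simp add: opoly_pCons_apply scaleC_one eq_neg_iff_add_eq_0 algebra_simps blinfun.add_right)

text \<open>The fundamental theorem of algebra splits off one linear factor at a time; each is
  bounded below by assumption, and so is their composition.\<close>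

lemma opoly_bounded_below:
  assumes "A \<in> bounded_ops" "p \<noteq> 0"
    and "\<And>z. poly p z = 0 \<Longrightarrow> bounded_below (opoly A [:- z, 1:])"
  shows "bounded_below (opoly A p)"
  using assms(2-)
proof (induction "degree p" arbitrary: p rule: less_induct)
  case less
  show ?case
  proof (cases "degree p = 0")
    case True
    then obtain c where "p = [:c:]" by (rule degree_eq_zeroE)
    with less.prems show ?thesis
      by (auto simp: bounded_below_def opoly_pCons_apply norm_scaleC intro!: exI[of _ "cmod c"])
  next
    case False
    then have "\<not> constant (poly p)" by (simp add: constant_degree)
    then obtain z where z: "poly p z = 0"
      using fundamental_theorem_of_algebra by blast
    then obtain q where q: "p = [:- z, 1:] * q"
      by (metis dvdE poly_eq_0_iff_dvd)
    have "q \<noteq> 0" using q less.prems(1) by auto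
    then have "degree p = Suc (degree q)" by (simp add: q degree_mult_eq del: mult_pCons_left)
    then have "bounded_below (opoly A q)"
      using less.hyps[of q] \<open>q \<noteq> 0\<close> less.prems(2) q by (auto simp del: mult_pCons_left)
    then show ?thesis
      using bounded_below_compose less.prems(2)[OF z] opoly_mult[OF assms(1)] q by metis
  qed
qed

section \<open>The spectrum of a selfadjoint operator: real and closed\<close>

text \<open>A bounded inverse gives a lower bound. Conversely, let \<open>T\<close> be
  \<open>A - z\<close> and \<open>T'\<close> its adjoint. A lower bound for \<open>T\<close> makes
  \<open>T' o\<^sub>L T\<close> coercive, hence onto; as the two factors commute, \<open>T\<close>
  itself is onto, and the lower bound makes its inverse exist and be bounded.\<close>

lemma not_in_spectrum_iff:
  assumes A: "A \<in> selfadjoint_ops"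
  shows "z \<notin> op_spectrum A \<longleftrightarrow> bounded_below (opoly A [:- z, 1:])"
proof
  assume "z \<notin> op_spectrum A"
  then obtain B where B: "\<And>x. blinfun_apply B (blinfun_apply A x - z *\<^sub>C x) = x"
    by (auto simp: op_spectrum_def)
  \<comment> \<open>The added 1 avoids a division by zero when \<open>B\<close> is zero, which
    happens on the trivial space.\<close>
  have "1 / (norm B + 1) * norm x \<le> norm (blinfun_apply A x - z *\<^sub>C x)" for x
  proof -
    have "norm x \<le> norm B * norm (blinfun_apply A x - z *\<^sub>C x)"
      using norm_blinfun[of B "blinfun_apply A x - z *\<^sub>C x"] by (simp add: B)
    also have "\<dots> \<le> (norm B + 1) * norm (blinfun_apply A x - z *\<^sub>C x)"
      by (intro mult_right_mono) auto
    finally show ?thesis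
      by (simp add: pos_divide_le_eq add_nonneg_pos mult.commute)
  qed
  moreover have "1 / (norm B + 1) > 0" by (simp add: add_nonneg_pos)
  ultimately show "bounded_below (opoly A [:- z, 1:])"
    unfolding bounded_below_def opoly_linear_apply by blast
next
  define T where "T = opoly A [:- z, 1:]"
  define T' where "T' = opoly A [:- cnj z, 1:]"
  have Abd: "A \<in> bounded_ops" by (rule selfadjointD(3)[OF A])
  assume "bounded_below (opoly A [:- z, 1:])"
  then obtain c where c: "c > 0" and bb: "\<And>x. c * norm x \<le> norm (blinfun_apply T x)"
    by (auto simp: bounded_below_def T_def)
  have "surj (blinfun_apply (T' o\<^sub>L T))"
  proof (rule coercive_surj)
    show "0 < c\<^sup>2" using c by simp
    fix x
    have "cinner (blinfun_apply T' (blinfun_apply T x)) x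
        = cinner (blinfun_apply T x) (blinfun_apply T x)"
      using opoly_adjoint[OF A, of "[:- cnj z, 1:]"] by (simp add: T_def T'_def map_poly_pCons)
    moreover have "c\<^sup>2 * (norm x)\<^sup>2 \<le> (norm (blinfun_apply T x))\<^sup>2"
      using power_mono[OF bb[of x], of 2] c by (simp add: power_mult_distrib)
    ultimately show "c\<^sup>2 * (norm x)\<^sup>2 \<le> Re (cinner (blinfun_apply (T' o\<^sub>L T) x) x)"
      by (simp add: cinner_self)
  qed
  moreover have comm: "T' o\<^sub>L T = T o\<^sub>L T'"
    unfolding T_def T'_def by (simp only: opoly_mult[OF Abd, symmetric] mult.commute)
  ultimately have surj': "surj (blinfun_apply (T o\<^sub>L T'))"
    by (simp only: comm)
  have surj: "surj (blinfun_apply T)"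
    unfolding surj_def
  proof
    fix y
    obtain x where "y = blinfun_apply (T o\<^sub>L T') x"
      using surj' by (rule surjE)
    then show "\<exists>x. y = blinfun_apply T x"
      unfolding blinfun_apply_blinfun_compose by (rule exI)
  qed
  have inj: "x = y" if "blinfun_apply T x = blinfun_apply T y" for x y
  proof -
    have "c * norm (x - y) \<le> 0" using bb[of "x - y"] that by (simp add: blinfun.diff_right)
    then show ?thesis using c by (simp add: mult_le_0_iff)
  qed
  define Q where "Q = inv (blinfun_apply T)"
  have TQ: "blinfun_apply T (Q y) = y" for y
    unfolding Q_def using surj by (rule surj_f_inv_f)
  have Tc: "blinfun_apply T (k *\<^sub>C x) = k *\<^sub>C blinfun_apply T x" for k x
    using opoly_in_bounded_ops[OF Abd] by (auto simp: T_def bounded_ops_def)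
  have Qbd: "bounded_linear Q"
  proof (rule bounded_linear_intro)
    show "Q (x + y) = Q x + Q y" for x y
      by (rule inj) (simp add: TQ blinfun.add_right)
    show "Q (r *\<^sub>R x) = r *\<^sub>R Q x" for r x
      by (rule inj) (simp add: TQ blinfun.scaleR_right)
    show "norm (Q x) \<le> norm x * inverse c" for x
      using bb[of "Q x"] c unfolding TQ divide_inverse[symmetric]
      by (simp only: pos_le_divide_eq mult.commute)
  qed
  have app: "blinfun_apply (Blinfun Q) y = Q y" for y
    by (simp add: bounded_linear_Blinfun_apply Qbd)
  have "Blinfun Q \<in> bounded_ops"
    unfolding bounded_ops_def mem_Collect_eq app
    by (intro allI, rule inj, simp only: TQ Tc)
  moreover have "Q (blinfun_apply T x) = x" for x
    by (rule inj) (rule TQ)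
  ultimately have "\<exists>B\<in>bounded_ops. \<forall>x. blinfun_apply B (blinfun_apply T x) = x \<and>
      blinfun_apply T (blinfun_apply B x) = x"
    using TQ by (intro bexI[of _ "Blinfun Q"]) (simp_all only: app simp_thms)
  then show "z \<notin> op_spectrum A"
    unfolding op_spectrum_def T_def opoly_linear_apply by blast
qed

text \<open>The quadratic form of \<open>A\<close> is real, so that of \<open>A - z\<close> has
  imaginary part \<open>- Im z * (norm x)\<^sup>2\<close>. By Cauchy-Schwarz
  \<open>\<bar>Im z\<bar>\<close> is then a lower bound for \<open>A - z\<close>.\<close>

lemma spectrum_real:
  assumes A: "A \<in> selfadjoint_ops" and z: "z \<in> op_spectrum A"
  shows "z = complex_of_real (Re z)"
proof (rule ccontr)
  assume "z \<noteq> complex_of_real (Re z)"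
  then have im: "\<bar>Im z\<bar> > 0" by (auto simp: complex_eq_iff)
  have "\<bar>Im z\<bar> * norm x \<le> norm (blinfun_apply (opoly A [:- z, 1:]) x)" for x
  proof (cases "x = 0")
    case False
    have "Im (cinner (blinfun_apply (opoly A [:- z, 1:]) x) x) = - Im z * (norm x)\<^sup>2"
      using arg_cong[OF cinner_selfadjoint_real[OF A, of x], of Im]
      by (simp add: opoly_linear_apply cinner_diff_left cinner_scaleC_left cinner_self
          del: of_real_power)
    then have "\<bar>Im z\<bar> * (norm x)\<^sup>2 \<le> cmod (cinner (blinfun_apply (opoly A [:- z, 1:]) x) x)"
      using abs_Im_le_cmod[of "cinner (blinfun_apply (opoly A [:- z, 1:]) x) x"]
      by (simp add: abs_mult)
    also have "\<dots> \<le> norm (blinfun_apply (opoly A [:- z, 1:]) x) * norm x"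
      by (rule cmod_cinner_le)
    finally show ?thesis using False by (simp add: power2_eq_square)
  qed simp
  then have "bounded_below (opoly A [:- z, 1:])"
    unfolding bounded_below_def using im by blast
  then show False using z not_in_spectrum_iff[OF A] by blast
qed

lemma norm_scaleC_op_le: "norm (scaleC_op c :: 'a::complex_hilbert_space \<Rightarrow>\<^sub>L 'a) \<le> cmod c"
  by (rule norm_blinfun_bound) (simp_all add: norm_scaleC)

text \<open>A lower bound \<open>c\<close> for \<open>A - z\<close> leaves a positive one for
  \<open>A - w\<close> as long as \<open>dist w z < c\<close>, so the complement is open.\<close>

lemma closed_spectrum:
  assumes A: "A \<in> selfadjoint_ops"
  shows "closed (op_spectrum A)"
  unfolding closed_def open_dist
proof safe
  fix z assume "z \<notin> op_spectrum A"
  then obtain c where c: "c > 0"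
    and bb: "\<And>x. c * norm x \<le> norm (blinfun_apply (opoly A [:- z, 1:]) x)"
    using not_in_spectrum_iff[OF A] by (auto simp: bounded_below_def)
  have "w \<notin> op_spectrum A" if "dist w z < c" for w
  proof -
    have eq: "opoly A [:- w, 1:] = opoly A [:- z, 1:] - scaleC_op (w - z)"
      by (intro blinfun_eqI) (simp add: opoly_linear_apply blinfun.diff_left
          bounded_bilinear.diff_left[OF bounded_bilinear_scaleC])
    have "(c - norm (scaleC_op (w - z) :: 'a \<Rightarrow>\<^sub>L 'a)) * norm x
        \<le> norm (blinfun_apply (opoly A [:- w, 1:]) x)" for x
      unfolding eq by (rule bounded_below_perturb[OF bb])
    moreover have "c - norm (scaleC_op (w - z) :: 'a \<Rightarrow>\<^sub>L 'a) > 0"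
      using norm_scaleC_op_le[of "w - z", where 'a = 'a] that by (simp add: dist_norm)
    ultimately show ?thesis
      unfolding not_in_spectrum_iff[OF A] bounded_below_def by blast
  qed
  then show "\<exists>e>0. \<forall>y. dist y z < e \<longrightarrow> y \<in> - op_spectrum A"
    using c by auto
qed

text \<open>If \<open>cmod (poly p z)\<close> exceeded the norm, then \<open>poly p z - p(A)\<close>
  would be bounded below. It factors as \<open>q(A)\<close> after \<open>A - z\<close>, so
  \<open>A - z\<close> would be bounded below too, contrary to \<open>z\<close> being
  spectral.\<close>

lemma opoly_spectrum_le_norm:
  assumes A: "A \<in> selfadjoint_ops" and z: "z \<in> op_spectrum A"
  shows "cmod (poly p z) \<le> norm (opoly A p)"
proof (rule ccontr)
  assume "\<not> ?thesis"
  then have gt: "cmod (poly p z) - norm (opoly A p) > 0" by simp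
  have Abd: "A \<in> bounded_ops" by (rule selfadjointD(3)[OF A])
  have "poly ([:poly p z:] - p) z = 0" by simp
  then obtain q where q: "[:poly p z:] - p = q * [:- z, 1:]"
    by (metis dvdE poly_eq_0_iff_dvd mult.commute)
  have eq: "opoly A [:poly p z:] - opoly A p = opoly A q o\<^sub>L opoly A [:- z, 1:]"
    by (simp only: opoly_mult[OF Abd, symmetric] opoly_diff[OF Abd, symmetric] q)
  have "(cmod (poly p z) - norm (opoly A p)) * norm x
      \<le> norm (blinfun_apply (opoly A q o\<^sub>L opoly A [:- z, 1:]) x)" for x
    unfolding eq[symmetric]
    by (rule bounded_below_perturb) (simp add: opoly_pCons_apply norm_scaleC)
  then have 1: "(cmod (poly p z) - norm (opoly A p)) * norm x
      \<le> norm (opoly A q) * norm (blinfun_apply (opoly A [:- z, 1:]) x)" for x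
    using norm_blinfun order_trans by fastforce
  \<comment> \<open>The added 1 keeps the denominator positive even if \<open>opoly A q\<close> is
    zero.\<close>
  have "(cmod (poly p z) - norm (opoly A p)) / (norm (opoly A q) + 1) * norm x
      \<le> norm (blinfun_apply (opoly A [:- z, 1:]) x)" for x
  proof -
    have "(cmod (poly p z) - norm (opoly A p)) * norm x
      \<le> (norm (opoly A q) + 1) * norm (blinfun_apply (opoly A [:- z, 1:]) x)"
      using 1[of x] norm_ge_zero[of "blinfun_apply (opoly A [:- z, 1:]) x"]
      unfolding distrib_right mult_1 by linarith
    then show ?thesis
      by (simp add: pos_divide_le_eq add_nonneg_pos mult.commute)
  qed
  moreover have "(cmod (poly p z) - norm (opoly A p)) / (norm (opoly A q) + 1) > 0"
    using gt by (simp add: add_nonneg_pos)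
  ultimately have "bounded_below (opoly A [:- z, 1:])"
    unfolding bounded_below_def by blast
  then show False using z not_in_spectrum_iff[OF A] by blast
qed

text \<open>With \<open>T = opoly A p\<close> of norm \<open>N\<close>, the operator is small on
  vectors where \<open>T\<close> nearly attains \<open>N\<close>, as \<open>est\<close> makes
  precise. A lower bound \<open>c\<close> would therefore force the norm of \<open>T\<close>
  strictly below \<open>N\<close>.\<close>

lemma opoly_norm_not_bounded_below:
  assumes A: "A \<in> selfadjoint_ops" and N: "norm (opoly A p) > 0"
  shows "\<not> bounded_below
    (opoly A (map_poly cnj p * p - [:complex_of_real ((norm (opoly A p))\<^sup>2):]))"
proof -
  define N where "N = norm (opoly A p)"
  define T where "T = opoly A p"
  define p' where "p' = map_poly cnj p"
  define q where "q = p' * p - [:complex_of_real (N\<^sup>2):]"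
  have Abd: "A \<in> bounded_ops" by (rule selfadjointD(3)[OF A])
  have N0: "N > 0" "norm T = N" using N by (auto simp: N_def T_def)
  have q_apply: "blinfun_apply (opoly A q) x =
      blinfun_apply (opoly A p') (blinfun_apply T x) - N\<^sup>2 *\<^sub>R x" for x
    by (simp add: q_def opoly_diff[OF Abd] opoly_mult[OF Abd] blinfun.diff_left T_def
        opoly_pCons_apply scaleR_scaleC)
  have adj: "cinner (blinfun_apply (opoly A p') y) x = cinner y (blinfun_apply T x)" for x y
    using opoly_adjoint[OF A, of p'] by (simp add: p'_def T_def map_poly_map_poly o_def)
  \<comment> \<open>The adjoint has norm at most \<open>N\<close>: pair its value \<open>?w\<close>
    with itself and move the adjoint across as \<open>T\<close>.\<close>
  have p'_norm: "norm (blinfun_apply (opoly A p') y) \<le> N * norm y" for y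
  proof (cases "blinfun_apply (opoly A p') y = 0")
    case False
    let ?w = "blinfun_apply (opoly A p') y"
    have "(norm ?w)\<^sup>2 = cmod (cinner ?w ?w)"
      by (simp add: cinner_self norm_power)
    also have "\<dots> \<le> norm y * norm (blinfun_apply T ?w)"
      unfolding adj by (rule cmod_cinner_le)
    also have "\<dots> \<le> norm y * (N * norm ?w)"
      using norm_blinfun[of T ?w] N0 by (intro mult_left_mono) auto
    finally show ?thesis using False by (simp add: power2_eq_square mult_ac)
  qed (use N0 in simp)
  have est: "(norm (blinfun_apply (opoly A q) x))\<^sup>2
      \<le> N\<^sup>2 * (N\<^sup>2 * (norm x)\<^sup>2 - (norm (blinfun_apply T x))\<^sup>2)" for x
  proof -
    have "(norm (blinfun_apply (opoly A p') (blinfun_apply T x)))\<^sup>2 \<le> N\<^sup>2 * (norm (blinfun_apply T x))\<^sup>2"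
      using power_mono[OF p'_norm, of "blinfun_apply T x" 2] by (simp add: power_mult_distrib)
    moreover have "Re (cinner (blinfun_apply (opoly A p') (blinfun_apply T x)) (N\<^sup>2 *\<^sub>R x))
        = N\<^sup>2 * (norm (blinfun_apply T x))\<^sup>2"
      by (simp add: cinner_scaleR_right adj cinner_self flip: of_real_power of_real_mult)
    ultimately show ?thesis
      by (simp add: q_apply norm_diff_square power_mult_distrib algebra_simps)
  qed
  have "\<not> bounded_below (opoly A q)"
  proof
    assume "bounded_below (opoly A q)"
    then obtain c where c: "c > 0" and bb: "\<And>x. c * norm x \<le> norm (blinfun_apply (opoly A q) x)"
      by (auto simp: bounded_below_def)
    \<comment> \<open>The \<open>max\<close> with 0 makes \<open>M\<close> a valid norm bound
      without first proving \<open>c \<le> N\<^sup>2\<close>.\<close>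
    define M where "M = sqrt (max 0 (N\<^sup>2 - c\<^sup>2 / N\<^sup>2))"
    have "norm (blinfun_apply T x) \<le> M * norm x" for x
    proof (rule power2_le_imp_le)
      have "c\<^sup>2 * (norm x)\<^sup>2 \<le> N\<^sup>2 * (N\<^sup>2 * (norm x)\<^sup>2 - (norm (blinfun_apply T x))\<^sup>2)"
        using power_mono[OF bb[of x], of 2] c est[of x] by (simp add: power_mult_distrib)
      then have "(norm (blinfun_apply T x))\<^sup>2 \<le> (N\<^sup>2 - c\<^sup>2 / N\<^sup>2) * (norm x)\<^sup>2"
        using N0 by (simp add: field_simps)
      also have "\<dots> \<le> max 0 (N\<^sup>2 - c\<^sup>2 / N\<^sup>2) * (norm x)\<^sup>2"
        by (intro mult_right_mono) auto
      finally show "(norm (blinfun_apply T x))\<^sup>2 \<le> (M * norm x)\<^sup>2"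
        by (simp add: M_def power_mult_distrib)
    qed (simp add: M_def)
    then have "N \<le> M"
      using norm_blinfun_bound[of M T] N0 by (simp add: M_def)
    then have "N\<^sup>2 \<le> M\<^sup>2" using N0 by (simp add: power_mono)
    moreover have "M\<^sup>2 < N\<^sup>2" using N0 c by (simp add: M_def)
    ultimately show False by simp
  qed
  then show ?thesis by (simp add: q_def p'_def N_def)
qed

section \<open>Spectral points as roots, and the isometry for polynomials\<close>

lemma root_in_spectrum:
  assumes A: "A \<in> selfadjoint_ops" and "q \<noteq> 0" and "\<not> bounded_below (opoly A q)"
  obtains z where "z \<in> op_spectrum A" "poly q z = 0"
  using opoly_bounded_below[OF selfadjointD(3)[OF A] assms(2)] assms(3) not_in_spectrum_iff[OF A]
  by blast

text \<open>For nonzero \<open>A\<close> a spectral point is found among the roots of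
  \<open>z\<^sup>2 - (norm A)\<^sup>2\<close>. For \<open>A = 0\<close> the point 0 is spectral,
  because the zero operator is not bounded below on a nontrivial space.\<close>

lemma spectrum_nonempty:
  fixes A :: "'a::complex_hilbert_space \<Rightarrow>\<^sub>L 'a"
  assumes A: "A \<in> selfadjoint_ops" and x: "(x::'a) \<noteq> 0"
  shows "op_spectrum A \<noteq> {}"
proof (cases "A = 0")
  case True
  have "\<not> bounded_below (0 :: 'a \<Rightarrow>\<^sub>L 'a)"
    using x by (auto simp: bounded_below_def mult_le_0_iff)
  with True show ?thesis
    using root_in_spectrum[OF A, of "[:0, 1:]"] by (auto simp: opoly_X)
next
  case False
  let ?q = "map_poly cnj [:0, 1:] * [:0, 1:] - [:complex_of_real ((norm (opoly A [:0, 1:]))\<^sup>2):]"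
  \<comment> \<open>The leading coefficient shows that the polynomial is not zero, as finding a root
    requires.\<close>
  have "coeff ?q 2 = 1" by (simp add: map_poly_pCons numeral_2_eq_2)
  then have "?q \<noteq> 0" by (intro notI) (simp only: coeff_0 zero_neq_one)
  moreover have "\<not> bounded_below (opoly A ?q)"
    using False by (intro opoly_norm_not_bounded_below[OF A]) (simp add: opoly_X)
  ultimately show ?thesis
    using root_in_spectrum[OF A] by blast
qed

text \<open>\<open>q\<close> represents the adjoint of \<open>p(A)\<close> times
  \<open>p(A)\<close>, minus \<open>N\<^sup>2\<close>, which is not bounded below. So a root of
  \<open>q\<close> lies in the spectrum, and there the modulus of \<open>p\<close> is
  \<open>N\<close>.\<close>

lemma opoly_norm_attained:
  fixes A :: "'a::complex_hilbert_space \<Rightarrow>\<^sub>L 'a"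
  assumes A: "A \<in> selfadjoint_ops" and N: "norm (opoly A p) > 0"
  obtains z where "z \<in> op_spectrum A" "cmod (poly p z) = norm (opoly A p)"
proof -
  define N where "N = norm (opoly A p)"
  define q where "q = map_poly cnj p * p - [:complex_of_real (N\<^sup>2):]"
  have not_bb: "\<not> bounded_below (opoly A q)"
    using opoly_norm_not_bounded_below[OF A N] by (simp add: q_def N_def)
  have N0: "N > 0" using N by (simp add: N_def)
  have attained: "cmod (poly p z) = N" if "z \<in> op_spectrum A" "poly q z = 0" for z
  proof -
    \<comment> \<open>At a real point the conjugated polynomial takes the conjugate of the value of
      \<open>p\<close>, so \<open>q\<close> is the squared modulus minus
      \<open>N\<^sup>2\<close>.\<close>
    have "cnj z = z" using spectrum_real[OF A that(1)] by (metis complex_cnj_complex_of_real)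
    then have "complex_of_real ((cmod (poly p z))\<^sup>2) = complex_of_real (N\<^sup>2)"
      using that(2) unfolding complex_norm_square by (simp add: q_def mult.commute)
    then have "(cmod (poly p z))\<^sup>2 = N\<^sup>2" by (simp only: of_real_eq_iff)
    then show ?thesis by (rule power2_eq_imp_eq) (use N0 in simp_all)
  qed
  have "\<exists>z. z \<in> op_spectrum A \<and> poly q z = 0"
  proof (cases "q = 0")
    \<comment> \<open>This happens for instance when \<open>p\<close> is constant. Every spectral
      point then attains the norm, and it remains to have one.\<close>
    case True
    have "opoly A p \<noteq> 0" using N by auto
    then obtain x :: 'a where "blinfun_apply (opoly A p) x \<noteq> blinfun_apply 0 x"
      by (meson blinfun_eqI)
    then have "x \<noteq> 0" by (auto simp: blinfun.zero_right)
    then show ?thesis using True spectrum_nonempty[OF A] by auto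
  next
    case False
    then obtain z where "z \<in> op_spectrum A" "poly q z = 0"
      using not_bb by (rule root_in_spectrum[OF A])
    then show ?thesis by blast
  qed
  then obtain z where "z \<in> op_spectrum A" "poly q z = 0" by blast
  then show ?thesis
    using that attained unfolding N_def by blast
qed

lemma opoly_norm_le_iff:
  assumes A: "A \<in> selfadjoint_ops" and "r \<ge> 0"
  shows "norm (opoly A p) \<le> r \<longleftrightarrow> (\<forall>z\<in>op_spectrum A. cmod (poly p z) \<le> r)"
proof
  show "norm (opoly A p) \<le> r \<Longrightarrow> \<forall>z\<in>op_spectrum A. cmod (poly p z) \<le> r"
    using opoly_spectrum_le_norm[OF A] order_trans by blast
  show "norm (opoly A p) \<le> r" if "\<forall>z\<in>op_spectrum A. cmod (poly p z) \<le> r"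
  proof (rule ccontr)
    assume gt: "\<not> norm (opoly A p) \<le> r"
    with \<open>r \<ge> 0\<close> have "norm (opoly A p) > 0" by linarith
    then obtain z where "z \<in> op_spectrum A" "cmod (poly p z) = norm (opoly A p)"
      by (rule opoly_norm_attained[OF A])
    with that gt show False by auto
  qed
qed

lemma compact_spectrum:
  assumes A: "A \<in> selfadjoint_ops"
  shows "compact (op_spectrum A)"
  using opoly_spectrum_le_norm[OF A, of _ "[:0, 1:]"] closed_spectrum[OF A]
  by (auto simp: compact_eq_bounded_closed bounded_iff)

section \<open>The continuous functional calculus\<close>

text \<open>Stone-Weierstrass produces polynomials in real-linear functionals of the complex plane.
  On the real axis such a functional is multiplication by its value at 1, so these become ordinary
  polynomials there.\<close>

lemma real_polynomial_function_poly:
  fixes f :: "complex \<Rightarrow> real"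
  assumes "real_polynomial_function f"
  shows "\<exists>p. \<forall>x::real. complex_of_real (f (complex_of_real x)) = poly p (complex_of_real x)"
  using assms
proof induction
  case (linear f)
  have "f (complex_of_real x) = x * f 1" for x
    using linear_simps(5)[OF linear, of x 1] by (simp add: scaleR_conv_of_real)
  then show ?case
    by (intro exI[of _ "[:0, complex_of_real (f 1):]"]) simp
next
  case (const c)
  show ?case by (rule exI[of _ "[:complex_of_real c:]"]) simp
next
  case (add f g)
  then obtain p q where "\<forall>x::real. complex_of_real (f (complex_of_real x)) = poly p (complex_of_real x)"
    "\<forall>x::real. complex_of_real (g (complex_of_real x)) = poly q (complex_of_real x)" by blast
  then show ?case by (intro exI[of _ "p + q"]) simp
next
  case (mult f g)
  then obtain p q where "\<forall>x::real. complex_of_real (f (complex_of_real x)) = poly p (complex_of_real x)"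
    "\<forall>x::real. complex_of_real (g (complex_of_real x)) = poly q (complex_of_real x)" by blast
  then show ?case by (intro exI[of _ "p * q"]) simp
qed

text \<open>Real and imaginary part are approximated separately, each within \<open>e / 2\<close>.
  Because \<open>K\<close> lies on the real axis, polynomials in \<open>z\<close> without its
  conjugate suffice.\<close>

lemma Weierstrass_complex_poly:
  fixes g :: "complex \<Rightarrow> complex"
  assumes K: "compact K" and real: "\<And>z. z \<in> K \<Longrightarrow> z = complex_of_real (Re z)"
    and g: "continuous_on K g" and e: "e > 0"
  obtains p where "\<And>z. z \<in> K \<Longrightarrow> cmod (poly p z - g z) < e"
proof -
  have *: "\<exists>p. \<forall>z\<in>K. cmod (poly p z - complex_of_real (h z)) < e / 2"
    if h: "continuous_on K h" for h :: "complex \<Rightarrow> real"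
  proof -
    obtain f where f: "real_polynomial_function f" "\<And>x. x \<in> K \<Longrightarrow> \<bar>h x - f x\<bar> < e / 2"
      using Stone_Weierstrass_real_polynomial_function[OF K h, of "e / 2"] e by auto
    obtain p where p: "\<And>x::real. complex_of_real (f (complex_of_real x)) = poly p (complex_of_real x)"
      using real_polynomial_function_poly[OF f(1)] by blast
    have "cmod (poly p z - complex_of_real (h z)) < e / 2" if z: "z \<in> K" for z
    proof -
      have "poly p z = complex_of_real (f z)"
        using p[of "Re z"] real[OF z] by simp
      then have "cmod (poly p z - complex_of_real (h z)) = \<bar>f z - h z\<bar>"
        by (simp flip: of_real_diff)
      then show ?thesis using f(2)[OF z] by (simp add: abs_minus_commute)
    qed
    then show ?thesis by blast
  qed
  obtain p where p: "\<And>z. z \<in> K \<Longrightarrow> cmod (poly p z - complex_of_real (Re (g z))) < e / 2"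
    using *[of "\<lambda>z. Re (g z)"] g by (auto intro: continuous_intros)
  obtain q where q: "\<And>z. z \<in> K \<Longrightarrow> cmod (poly q z - complex_of_real (Im (g z))) < e / 2"
    using *[of "\<lambda>z. Im (g z)"] g by (auto intro: continuous_intros)
  have "cmod (poly (p + smult \<i> q) z - g z) < e" if z: "z \<in> K" for z
  proof -
    have "poly (p + smult \<i> q) z - g z =
        (poly p z - complex_of_real (Re (g z))) + \<i> * (poly q z - complex_of_real (Im (g z)))"
      by (subst (1) complex_eq[of "g z"]) (simp add: algebra_simps)
    then have "cmod (poly (p + smult \<i> q) z - g z) \<le>
        cmod (poly p z - complex_of_real (Re (g z))) + cmod (poly q z - complex_of_real (Im (g z)))"
      by (metis norm_triangle_ineq norm_mult norm_ii mult_1)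
    then show ?thesis using p[OF z] q[OF z] by linarith
  qed
  then show ?thesis using that by blast
qed

text \<open>\<open>T\<close> is the value at \<open>g\<close> of the continuous calculus of \<open>A\<close>; the relation avoids choosing
  the approximating polynomials.\<close>

definition calculus_limit ::
    "('a::complex_hilbert_space \<Rightarrow>\<^sub>L 'a) \<Rightarrow> (complex \<Rightarrow> complex) \<Rightarrow> ('a \<Rightarrow>\<^sub>L 'a) \<Rightarrow> bool"
  where "calculus_limit A g T \<longleftrightarrow>
    (\<exists>P. uniform_limit (op_spectrum A) (\<lambda>n. poly (P n)) g sequentially \<and>
         (\<lambda>n. opoly A (P n)) \<longlonglongrightarrow> T)"

section \<open>Algebra of the limit relation\<close>

lemma calculus_limit_poly: "calculus_limit A (poly p) (opoly A p)"
  unfolding calculus_limit_def by (rule exI[of _ "\<lambda>n. p"]) (auto intro: uniform_limit_const)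

lemma poly_fun_eqs:
  "poly (p + q) = (\<lambda>z. poly p z + poly q z)"
  "poly (p - q) = (\<lambda>z. poly p z - poly q z)"
  "poly (p * q) = (\<lambda>z. poly p z * poly q z)"
  for p q :: "complex poly"
  by auto

lemma calculus_limit_add:
  assumes "calculus_limit A g T" "calculus_limit A h U"
  shows "calculus_limit A (\<lambda>z. g z + h z) (T + U)"
proof -
  obtain P Q where "uniform_limit (op_spectrum A) (\<lambda>n. poly (P n)) g sequentially"
    "(\<lambda>n. opoly A (P n)) \<longlonglongrightarrow> T"
    "uniform_limit (op_spectrum A) (\<lambda>n. poly (Q n)) h sequentially"
    "(\<lambda>n. opoly A (Q n)) \<longlonglongrightarrow> U"
    using assms by (auto simp: calculus_limit_def)
  then show ?thesis
    unfolding calculus_limit_def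
    by (intro exI[of _ "\<lambda>n. P n + Q n"])
      (auto simp: opoly_add poly_fun_eqs intro: uniform_limit_add tendsto_add)
qed

lemma calculus_limit_mult:
  assumes A: "A \<in> selfadjoint_ops"
    and "calculus_limit A g T" "calculus_limit A h U"
    and "continuous_on (op_spectrum A) g" "continuous_on (op_spectrum A) h"
  shows "calculus_limit A (\<lambda>z. g z * h z) (T o\<^sub>L U)"
proof -
  obtain P Q where "uniform_limit (op_spectrum A) (\<lambda>n. poly (P n)) g sequentially"
    "(\<lambda>n. opoly A (P n)) \<longlonglongrightarrow> T"
    "uniform_limit (op_spectrum A) (\<lambda>n. poly (Q n)) h sequentially"
    "(\<lambda>n. opoly A (Q n)) \<longlonglongrightarrow> U"
    using assms by (auto simp: calculus_limit_def)
  \<comment> \<open>Boundedness of both limit functions makes the products converge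
    uniformly.\<close>
  moreover have "bounded (g ` op_spectrum A)" "bounded (h ` op_spectrum A)"
    using assms(4,5) compact_spectrum[OF A] by (auto intro: compact_imp_bounded compact_continuous_image)
  ultimately show ?thesis
    unfolding calculus_limit_def
    by (intro exI[of _ "\<lambda>n. P n * Q n"])
      (auto simp: opoly_mult[OF selfadjointD(3)[OF A]] poly_fun_eqs
        intro: uniform_lim_mult bounded_bilinear.tendsto[OF bounded_bilinear_blinfun_compose])
qed

lemma calculus_limit_scaleC:
  assumes A: "A \<in> selfadjoint_ops" and "calculus_limit A g T" "continuous_on (op_spectrum A) g"
  shows "calculus_limit A (\<lambda>z. c * g z) (scaleC_op c o\<^sub>L T)"
proof -
  have "opoly A [:c:] = scaleC_op c"
    by (rule blinfun_eqI) (simp add: opoly_pCons_apply)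
  moreover have "poly [:c:] = (\<lambda>z. c)" by auto
  ultimately have "calculus_limit A (\<lambda>z. c) (scaleC_op c)"
    using calculus_limit_poly[of A "[:c:]"] by simp
  then show ?thesis
    by (intro calculus_limit_mult[OF A] assms continuous_on_const)
qed

lemma calculus_limit_diff:
  assumes A: "A \<in> selfadjoint_ops"
    and "calculus_limit A g T" "calculus_limit A h U"
  shows "calculus_limit A (\<lambda>z. g z - h z) (T - U)"
proof -
  obtain P Q where "uniform_limit (op_spectrum A) (\<lambda>n. poly (P n)) g sequentially"
    "(\<lambda>n. opoly A (P n)) \<longlonglongrightarrow> T"
    "uniform_limit (op_spectrum A) (\<lambda>n. poly (Q n)) h sequentially"
    "(\<lambda>n. opoly A (Q n)) \<longlonglongrightarrow> U"
    using assms by (auto simp: calculus_limit_def)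
  then show ?thesis
    unfolding calculus_limit_def
    by (intro exI[of _ "\<lambda>n. P n - Q n"])
      (auto simp: opoly_diff[OF selfadjointD(3)[OF A]] poly_fun_eqs intro: uniform_limit_minus tendsto_diff)
qed

text \<open>The isometry for polynomials passes to the limit. An approximant may exceed
  \<open>r\<close> by its uniform error, hence the slack \<open>e\<close> in the converse
  direction.\<close>

lemma calculus_limit_norm_le_iff:
  assumes A: "A \<in> selfadjoint_ops" and "calculus_limit A g T" and r: "r \<ge> 0"
  shows "norm T \<le> r \<longleftrightarrow> (\<forall>z\<in>op_spectrum A. cmod (g z) \<le> r)"
proof -
  obtain P where P: "uniform_limit (op_spectrum A) (\<lambda>n. poly (P n)) g sequentially"
    and T: "(\<lambda>n. opoly A (P n)) \<longlonglongrightarrow> T"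
    using assms by (auto simp: calculus_limit_def)
  have "cmod (g z) \<le> norm T" if "z \<in> op_spectrum A" for z
  proof (rule LIMSEQ_le)
    show "(\<lambda>n. cmod (poly (P n) z)) \<longlonglongrightarrow> cmod (g z)"
      by (intro tendsto_norm tendsto_uniform_limitI[OF P that])
    show "(\<lambda>n. norm (opoly A (P n))) \<longlonglongrightarrow> norm T"
      by (intro tendsto_norm T)
    show "\<exists>N. \<forall>n\<ge>N. cmod (poly (P n) z) \<le> norm (opoly A (P n))"
      using opoly_spectrum_le_norm[OF A that] by blast
  qed
  moreover have "norm T \<le> r" if g: "\<forall>z\<in>op_spectrum A. cmod (g z) \<le> r"
  proof (rule field_le_epsilon)
    fix e :: real assume e: "e > 0"
    show "norm T \<le> r + e"
    proof (rule Lim_norm_ubound[OF _ T])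
      show "\<forall>\<^sub>F n in sequentially. norm (opoly A (P n)) \<le> r + e"
        using uniform_limitD[OF P e]
      proof eventually_elim
        case (elim n)
        have "cmod (poly (P n) z) \<le> r + e" if z: "z \<in> op_spectrum A" for z
        proof -
          have "dist (poly (P n) z) (g z) < e" "cmod (g z) \<le> r" using elim g z by auto
          then show ?thesis
            using norm_triangle_sub[of "poly (P n) z" "g z"] by (simp add: dist_norm)
        qed
        then show ?case using opoly_norm_le_iff[OF A, of "r + e"] r e by simp
      qed
    qed simp
  qed
  ultimately show ?thesis using order_trans by blast
qed

text \<open>The difference is a value at the zero function, so the isometry gives it norm 0.\<close>

lemma calculus_limit_unique:
  assumes A: "A \<in> selfadjoint_ops" and "calculus_limit A g T" "calculus_limit A g U"
  shows "T = U"
  using calculus_limit_norm_le_iff[OF A calculus_limit_diff[OF assms], of 0] by simp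

lemma calculus_limit_cong:
  assumes "calculus_limit A g T" "\<And>z. z \<in> op_spectrum A \<Longrightarrow> g z = h z"
  shows "calculus_limit A h T"
proof -
  have "uniform_limit (op_spectrum A) F g sequentially \<longleftrightarrow> uniform_limit (op_spectrum A) F h sequentially" for F
    by (rule uniform_limit_cong') (simp_all add: assms(2))
  then show ?thesis using assms(1) by (simp add: calculus_limit_def)
qed

text \<open>Approximating polynomials are uniformly Cauchy on the spectrum; by the isometry their
  operators are Cauchy in norm, and the operator space is complete.\<close>

lemma calculus_limit_exists:
  assumes A: "A \<in> selfadjoint_ops" and g: "continuous_on (op_spectrum A) g"
  shows "\<exists>T. calculus_limit A g T"
proof -
  have "\<exists>p. \<forall>z\<in>op_spectrum A. cmod (poly p z - g z) < inverse (real (Suc n))" for n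
    by (rule Weierstrass_complex_poly[OF compact_spectrum[OF A] spectrum_real[OF A] g,
          of "inverse (real (Suc n))"]) auto
  then obtain P where P: "\<And>n z. z \<in> op_spectrum A \<Longrightarrow> cmod (poly (P n) z - g z) < inverse (real (Suc n))"
    using choice[of "\<lambda>n p. \<forall>z\<in>op_spectrum A. cmod (poly p z - g z) < inverse (real (Suc n))"] by blast
  have unif: "uniform_limit (op_spectrum A) (\<lambda>n. poly (P n)) g sequentially"
  proof (rule uniform_limitI)
    fix e :: real assume "e > 0"
    then have "\<forall>\<^sub>F n in sequentially. inverse (real (Suc n)) < e"
      using LIMSEQ_inverse_real_of_nat order_tendstoD(2) by blast
    then show "\<forall>\<^sub>F n in sequentially. \<forall>z\<in>op_spectrum A. dist (poly (P n) z) (g z) < e"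
      by eventually_elim (use P less_trans in \<open>unfold dist_norm, blast\<close>)
  qed
  have "Cauchy (\<lambda>n. opoly A (P n))"
    unfolding Cauchy_iff
  proof (intro allI impI)
    fix e :: real assume "e > 0"
    then obtain M where M: "\<And>n z. n \<ge> M \<Longrightarrow> z \<in> op_spectrum A \<Longrightarrow> dist (poly (P n) z) (g z) < e / 3"
      using uniform_limitD[OF unif, of "e / 3"] by (auto simp: eventually_sequentially)
    have "norm (opoly A (P m) - opoly A (P n)) < e" if "m \<ge> M" "n \<ge> M" for m n
    proof -
      have "cmod (poly (P m - P n) z) \<le> 2 * e / 3" if z: "z \<in> op_spectrum A" for z
        using M[OF \<open>m \<ge> M\<close> z] M[OF \<open>n \<ge> M\<close> z] dist_triangle2[of "poly (P m) z" "poly (P n) z" "g z"]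
        by (simp add: dist_norm)
      then have "norm (opoly A (P m - P n)) \<le> 2 * e / 3"
        using opoly_norm_le_iff[OF A, of "2 * e / 3"] \<open>e > 0\<close> by simp
      then show ?thesis
        using \<open>e > 0\<close> by (simp add: opoly_diff[OF selfadjointD(3)[OF A]])
    qed
    then show "\<exists>M. \<forall>m\<ge>M. \<forall>n\<ge>M. norm (opoly A (P m) - opoly A (P n)) < e" by blast
  qed
  then obtain T where "(\<lambda>n. opoly A (P n)) \<longlonglongrightarrow> T"
    by (auto simp: Cauchy_convergent_iff convergent_def)
  with unif have "calculus_limit A g T"
    unfolding calculus_limit_def by (intro exI[of _ P] conjI)
  then show ?thesis ..
qed

lemma calculus_limit_in_bounded_ops:
  assumes A: "A \<in> selfadjoint_ops" and "calculus_limit A g T"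
  shows "T \<in> bounded_ops"
proof -
  obtain P where T: "(\<lambda>n. opoly A (P n)) \<longlonglongrightarrow> T"
    using assms by (auto simp: calculus_limit_def)
  have lim: "(\<lambda>n. blinfun_apply (opoly A (P n)) x) \<longlonglongrightarrow> blinfun_apply T x" for x
    by (intro tendsto_intros T)
  have "blinfun_apply T (c *\<^sub>C x) = c *\<^sub>C blinfun_apply T x" for c x
  proof (rule LIMSEQ_unique[OF lim])
    have "(\<lambda>n. c *\<^sub>C blinfun_apply (opoly A (P n)) x) \<longlonglongrightarrow> c *\<^sub>C blinfun_apply T x"
      by (intro bounded_bilinear.tendsto[OF bounded_bilinear_scaleC] lim tendsto_const)
    then show "(\<lambda>n. blinfun_apply (opoly A (P n)) (c *\<^sub>C x)) \<longlonglongrightarrow> c *\<^sub>C blinfun_apply T x"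
      using opoly_in_bounded_ops[OF selfadjointD(3)[OF A]] by (simp add: bounded_ops_def)
  qed
  then show ?thesis by (simp add: bounded_ops_def)
qed

text \<open>On the real spectrum the conjugated polynomials \<open>Q n\<close> take conjugate
  values, so the isometry makes their operators converge as well. By uniqueness their limit is
  \<open>U\<close>, and the adjoint relation for polynomials passes to the limit.\<close>

lemma calculus_limit_adjoint:
  assumes A: "A \<in> selfadjoint_ops" and "calculus_limit A g T"
    and U: "calculus_limit A (\<lambda>z. cnj (g z)) U"
  shows "is_adjoint T U"
proof -
  obtain P where P: "uniform_limit (op_spectrum A) (\<lambda>n. poly (P n)) g sequentially"
    and T: "(\<lambda>n. opoly A (P n)) \<longlonglongrightarrow> T"
    using assms by (auto simp: calculus_limit_def)
  define Q where "Q n = map_poly cnj (P n)" for n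
  have adj: "cinner (blinfun_apply (opoly A (Q n)) x) y = cinner x (blinfun_apply (opoly A (P n)) y)" for n x y
    using opoly_adjoint[OF A, of "Q n"] by (simp add: Q_def map_poly_map_poly o_def)
  have Q: "uniform_limit (op_spectrum A) (\<lambda>n. poly (Q n)) (\<lambda>z. cnj (g z)) sequentially"
  proof -
    have "cnj (poly (P n) z) = poly (Q n) z" if "z \<in> op_spectrum A" for z n
      using spectrum_real[OF A that] unfolding Q_def poly_map_poly_cnj
      by (metis complex_cnj_complex_of_real)
    moreover have "uniform_limit (op_spectrum A) (\<lambda>n z. cnj (poly (P n) z)) (\<lambda>z. cnj (g z)) sequentially"
      by (intro uniform_limit_intros P)
    ultimately show ?thesis
      by (subst uniform_limit_cong'[symmetric]) auto
  qed
  have norm_eq: "norm (opoly A (Q n) - opoly A (Q m)) \<le> norm (opoly A (P n) - opoly A (P m))" for m n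
  proof -
    have "cmod (poly (Q n - Q m) z) \<le> norm (opoly A (P n - P m))" if z: "z \<in> op_spectrum A" for z
    proof -
      have "cnj z = z" using spectrum_real[OF A z] by (metis complex_cnj_complex_of_real)
      then have "poly (Q n - Q m) z = cnj (poly (P n - P m) z)" by (simp add: Q_def)
      then show ?thesis
        using opoly_spectrum_le_norm[OF A z, of "P n - P m"] by (simp only: complex_mod_cnj)
    qed
    then show ?thesis
      using opoly_norm_le_iff[OF A, of "norm (opoly A (P n - P m))" "Q n - Q m"]
      by (simp add: opoly_diff[OF selfadjointD(3)[OF A]])
  qed
  have "Cauchy (\<lambda>n. opoly A (P n))" using T by (rule LIMSEQ_imp_Cauchy)
  then have "Cauchy (\<lambda>n. opoly A (Q n))"
    unfolding Cauchy_iff by (meson norm_eq order_le_less_trans)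
  then obtain U' where U': "(\<lambda>n. opoly A (Q n)) \<longlonglongrightarrow> U'"
    by (auto simp: Cauchy_convergent_iff convergent_def)
  have "calculus_limit A (\<lambda>z. cnj (g z)) U'"
    unfolding calculus_limit_def by (rule exI[of _ Q]) (intro conjI Q U')
  then have "U' = U" by (rule calculus_limit_unique[OF A _ U])
  have "cinner (blinfun_apply U x) y = cinner x (blinfun_apply T y)" for x y
  proof (rule LIMSEQ_unique)
    show "(\<lambda>n. cinner (blinfun_apply (opoly A (Q n)) x) y) \<longlonglongrightarrow> cinner (blinfun_apply U x) y"
      using U' \<open>U' = U\<close> by (intro bounded_bilinear.tendsto[OF bounded_bilinear_cinner] tendsto_intros) auto
    show "(\<lambda>n. cinner (blinfun_apply (opoly A (Q n)) x) y) \<longlonglongrightarrow> cinner x (blinfun_apply T y)"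
      unfolding adj
      using T by (intro bounded_bilinear.tendsto[OF bounded_bilinear_cinner] tendsto_intros) auto
  qed
  then show ?thesis
    unfolding is_adjoint_def by (metis cinner_commute)
qed

section \<open>Existence and uniqueness of the continuous calculus\<close>

text \<open>The algebraic clauses determine \<open>\<Phi>\<close> on polynomials by induction, and
  the isometry clause then determines it on their uniform limits.\<close>

lemma continuous_calculus_eq_calculus_limit:
  assumes A: "A \<in> selfadjoint_ops" and \<Phi>: "is_continuous_calculus A \<Phi>"
    and g: "continuous_on (op_spectrum A) g"
  shows "calculus_limit A g (\<Phi> g)"
proof -
  note \<Phi>' = \<Phi>[unfolded is_continuous_calculus_def]
  have scale: "\<Phi> (\<lambda>z. c * g z) = scaleC_op c o\<^sub>L \<Phi> g" if "continuous_on (op_spectrum A) g" for c g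
  proof (rule blinfun_eqI)
    have "\<forall>c x. blinfun_apply (\<Phi> (\<lambda>z. c * g z)) x = c *\<^sub>C blinfun_apply (\<Phi> g) x"
      using \<Phi>' that by blast
    then show "blinfun_apply (\<Phi> (\<lambda>z. c * g z)) x = blinfun_apply (scaleC_op c o\<^sub>L \<Phi> g) x" for x
      by simp
  qed
  have neg: "scaleC_op (- 1) o\<^sub>L T = - T" for T :: "'a \<Rightarrow>\<^sub>L 'a"
    by (rule blinfun_eqI) (use scaleR_scaleC[of "-1", where 'a = 'a] in \<open>simp add: blinfun.minus_left\<close>)
  have mult: "\<Phi> (\<lambda>z. g z * h z) = \<Phi> g o\<^sub>L \<Phi> h"
    and add: "\<Phi> (\<lambda>z. g z + h z) = \<Phi> g + \<Phi> h"
    if "continuous_on (op_spectrum A) g" "continuous_on (op_spectrum A) h" for g h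
    using \<Phi>' that by blast+
  have one: "\<Phi> (\<lambda>z. 1) = id_blinfun" and X: "\<Phi> (\<lambda>z. z) = A"
    using \<Phi>' by blast+
  have norm_le: "norm (\<Phi> g) \<le> r \<longleftrightarrow> (\<forall>z\<in>op_spectrum A. cmod (g z) \<le> r)"
    if "continuous_on (op_spectrum A) g" "r \<ge> 0" for g r
    using \<Phi>' that by blast
  have const: "\<Phi> (\<lambda>z. c) = scaleC_op c" for c
    using scale[of "\<lambda>z. 1" c] by (auto simp: one intro!: blinfun_eqI)
  have poly: "\<Phi> (poly p) = opoly A p" for p
  proof (induction p)
    case 0
    have "poly 0 = (\<lambda>z::complex. 0)" by auto
    then show ?case using const[of 0] by (auto intro!: blinfun_eqI)
  next
    case (pCons a p)
    have "poly (pCons a p) = (\<lambda>z. a + z * poly p z)" by auto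
    then show ?case
      by (simp add: opoly_pCons add mult const X pCons.IH continuous_intros)
  qed
  obtain T where T: "calculus_limit A g T" using calculus_limit_exists[OF A g] by blast
  then obtain P where P: "uniform_limit (op_spectrum A) (\<lambda>n. poly (P n)) g sequentially"
    and PT: "(\<lambda>n. opoly A (P n)) \<longlonglongrightarrow> T"
    by (auto simp: calculus_limit_def)
  have "(\<lambda>n. opoly A (P n)) \<longlonglongrightarrow> \<Phi> g"
  proof (rule tendstoI)
    fix e :: real assume "e > 0"
    \<comment> \<open>Half of \<open>e\<close>, because the norm clause returns only a weak
      inequality.\<close>
    then have "\<forall>\<^sub>F n in sequentially. \<forall>z\<in>op_spectrum A. dist (poly (P n) z) (g z) < e / 2"
      by (intro uniform_limitD[OF P]) simp
    then show "\<forall>\<^sub>F n in sequentially. dist (opoly A (P n)) (\<Phi> g) < e"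
    proof eventually_elim
      case (elim n)
      have cont: "continuous_on (op_spectrum A) (poly (P n))" by (intro continuous_intros)
      \<comment> \<open>The clauses speak of sums and multiples only, so the difference is written
        with the multiple by \<open>- 1\<close>.\<close>
      have "\<Phi> (\<lambda>z. (- 1) * g z) = - \<Phi> g"
        by (simp only: scale[OF g] neg)
      moreover have "\<Phi> (\<lambda>z. poly (P n) z + (- 1) * g z) = \<Phi> (poly (P n)) + \<Phi> (\<lambda>z. (- 1) * g z)"
        by (rule add[OF cont]) (intro continuous_intros g)
      ultimately have "\<Phi> (\<lambda>z. poly (P n) z + (- 1) * g z) = opoly A (P n) - \<Phi> g"
        by (simp only: poly diff_conv_add_uminus)
      moreover have "norm (\<Phi> (\<lambda>z. poly (P n) z + (- 1) * g z)) \<le> e / 2"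
        using elim \<open>e > 0\<close>
        by (subst norm_le) (auto simp: dist_norm less_imp_le intro!: continuous_intros cont g)
      ultimately show ?case using \<open>e > 0\<close> by (simp add: dist_norm)
    qed
  qed
  then have "T = \<Phi> g" using PT LIMSEQ_unique by blast
  with T show ?thesis by simp
qed

text \<open>On functions continuous on the spectrum the limit exists and is unique, so
  \<open>SOME\<close> picks that limit; elsewhere the calculus is unconstrained.\<close>

lemma continuous_calculus_exists:
  assumes A: "A \<in> selfadjoint_ops"
  shows "is_continuous_calculus A (\<lambda>g. SOME T. calculus_limit A g T)" (is "is_continuous_calculus A ?\<Phi>")
proof -
  have lim: "calculus_limit A g (?\<Phi> g)" if "continuous_on (op_spectrum A) g" for g
    using calculus_limit_exists[OF A that] by (rule someI_ex)
  have eq: "?\<Phi> g = T" if "calculus_limit A g T" for g T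
    using someI[of "calculus_limit A g" T] that calculus_limit_unique[OF A] by blast
  show ?thesis
    unfolding is_continuous_calculus_def
  proof (intro conjI allI impI)
    fix g :: "complex \<Rightarrow> complex" assume g: "continuous_on (op_spectrum A) g"
    show "?\<Phi> g \<in> bounded_ops" by (rule calculus_limit_in_bounded_ops[OF A lim[OF g]])
    show "blinfun_apply (?\<Phi> (\<lambda>z. c * g z)) x = c *\<^sub>C blinfun_apply (?\<Phi> g) x" for c x
      by (subst eq[OF calculus_limit_scaleC[OF A lim[OF g] g]]) simp
    show "is_adjoint (?\<Phi> g) (?\<Phi> (\<lambda>z. cnj (g z)))"
      by (rule calculus_limit_adjoint[OF A lim[OF g] lim]) (intro continuous_intros g)
    show "norm (?\<Phi> g) \<le> r \<longleftrightarrow> (\<forall>z\<in>op_spectrum A. cmod (g z) \<le> r)" if "0 \<le> r" for r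
      by (rule calculus_limit_norm_le_iff[OF A lim[OF g] that])
    fix h :: "complex \<Rightarrow> complex" assume h: "continuous_on (op_spectrum A) h"
    show "?\<Phi> (\<lambda>z. g z + h z) = ?\<Phi> g + ?\<Phi> h"
      by (intro eq calculus_limit_add lim g h)
    show "?\<Phi> (\<lambda>z. g z * h z) = ?\<Phi> g o\<^sub>L ?\<Phi> h"
      by (intro eq calculus_limit_mult[OF A] lim g h)
  next
    have "poly 1 = (\<lambda>z::complex. 1)" "poly [:0, 1:] = (\<lambda>z::complex. z)" by auto
    then show "?\<Phi> (\<lambda>z. 1) = id_blinfun" "?\<Phi> (\<lambda>z. z) = A"
      using calculus_limit_poly[of A 1] calculus_limit_poly[of A "[:0, 1:]"]
      by (auto intro!: eq simp: opoly_1 opoly_X)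
  qed
qed

text \<open>Existence and uniqueness of the calculus let the definite description in
  \<open>op_fun\<close> denote its value.\<close>

lemma calculus_limit_op_fun:
  assumes A: "A \<in> selfadjoint_ops"
    and f: "continuous_on (op_spectrum A) (\<lambda>z. complex_of_real (f (Re z)))"
  shows "calculus_limit A (\<lambda>z. complex_of_real (f (Re z))) (op_fun f A)"
proof -
  let ?g = "\<lambda>z. complex_of_real (f (Re z))"
  obtain \<Phi> where \<Phi>: "is_continuous_calculus A \<Phi>"
    using continuous_calculus_exists[OF A] by blast
  have "op_fun f A = \<Phi> ?g"
    unfolding op_fun_def
    using continuous_calculus_eq_calculus_limit[OF A _ f] calculus_limit_unique[OF A] \<Phi>
    by (intro the_equality) blast+
  then show ?thesis
    using continuous_calculus_eq_calculus_limit[OF A \<Phi> f] by simp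
qed

lemma calculus_limit_selfadjoint:
  assumes A: "A \<in> selfadjoint_ops" and "calculus_limit A (\<lambda>z. complex_of_real (h z)) T"
  shows "T \<in> selfadjoint_ops"
  using calculus_limit_adjoint[OF assms, of T] calculus_limit_in_bounded_ops[OF assms] assms(2)
  by (simp add: selfadjoint_ops_def)

text \<open>The calculus at \<open>sqrt (h z)\<close> yields a selfadjoint \<open>U\<close> with
  square \<open>T\<close>, so the quadratic form of \<open>T\<close> at \<open>x\<close> is the
  squared norm of \<open>U x\<close>.\<close>

lemma calculus_limit_nonneg:
  assumes A: "A \<in> selfadjoint_ops" and T: "calculus_limit A (\<lambda>z. complex_of_real (h z)) T"
    and h: "continuous_on (op_spectrum A) h" "\<And>z. z \<in> op_spectrum A \<Longrightarrow> 0 \<le> h z"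
  shows "0 \<le> Re (cinner (blinfun_apply T x) x)"
proof -
  let ?g = "\<lambda>z. complex_of_real (sqrt (h z))"
  have g: "continuous_on (op_spectrum A) ?g" using h(1) by (intro continuous_intros)
  obtain U where U: "calculus_limit A ?g U" using calculus_limit_exists[OF A g] by blast
  have "calculus_limit A (\<lambda>z. ?g z * ?g z) (U o\<^sub>L U)"
    by (rule calculus_limit_mult[OF A U U g g])
  then have "calculus_limit A (\<lambda>z. complex_of_real (h z)) (U o\<^sub>L U)"
    by (rule calculus_limit_cong) (use h(2) in \<open>simp flip: of_real_mult\<close>)
  then have "T = U o\<^sub>L U" using calculus_limit_unique[OF A T] by blast
  then have "cinner (blinfun_apply T x) x = cinner (blinfun_apply U x) (blinfun_apply U x)"
    using calculus_limit_selfadjoint[OF A U] by (simp add: selfadjointD(2))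
  then show ?thesis by (simp add: cinner_ge_zero)
qed

section \<open>Bounds, continuity and the trapezoid inequality\<close>

text \<open>On the spectrum the linear polynomials \<open>z - m\<close> and \<open>M - z\<close> are
  nonnegative, so their values at \<open>A\<close> are positive operators.\<close>

lemma selfadjoint_bounds_if_spectrum:
  assumes A: "A \<in> selfadjoint_ops" and spec: "op_spectrum A \<subseteq> complex_of_real ` {m..M}"
  shows "m * (norm x)\<^sup>2 \<le> Re (cinner (blinfun_apply A x) x)"
    and "Re (cinner (blinfun_apply A x) x) \<le> M * (norm x)\<^sup>2"
proof -
  have mem: "m \<le> Re z" "Re z \<le> M" "z = complex_of_real (Re z)" if "z \<in> op_spectrum A" for z
    using that spec by auto
  have "calculus_limit A (\<lambda>z. complex_of_real (Re z - m)) (opoly A [:- complex_of_real m, 1:])"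
    by (rule calculus_limit_cong[OF calculus_limit_poly]) (use mem(3) in \<open>simp add: complex_eq_iff\<close>)
  then have "0 \<le> Re (cinner (blinfun_apply (opoly A [:- complex_of_real m, 1:]) x) x)"
    by (rule calculus_limit_nonneg[OF A]) (use mem in \<open>auto intro!: continuous_intros\<close>)
  then show "m * (norm x)\<^sup>2 \<le> Re (cinner (blinfun_apply A x) x)"
    by (simp add: opoly_linear_apply cinner_diff_left cinner_scaleC_left cinner_self
        flip: of_real_power)
  have "calculus_limit A (\<lambda>z. complex_of_real (M - Re z)) (opoly A [:complex_of_real M, - 1:])"
    by (rule calculus_limit_cong[OF calculus_limit_poly]) (use mem(3) in \<open>simp add: complex_eq_iff\<close>)
  then have "0 \<le> Re (cinner (blinfun_apply (opoly A [:complex_of_real M, - 1:]) x) x)"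
    by (rule calculus_limit_nonneg[OF A]) (use mem in \<open>auto intro!: continuous_intros\<close>)
  then show "Re (cinner (blinfun_apply A x) x) \<le> M * (norm x)\<^sup>2"
    by (simp add: opoly_pCons_apply cinner_add_left cinner_scaleC_left cinner_self
        selfadjointD(1)[OF A] blinfun.add_right flip: of_real_power)
qed

text \<open>For real \<open>r\<close> outside the interval the quadratic form of
  \<open>A - r\<close> keeps a fixed distance from zero on unit vectors, so by Cauchy-Schwarz
  \<open>A - r\<close> is bounded below.\<close>

lemma spectrum_subset_if_bounds:
  assumes A: "A \<in> selfadjoint_ops"
    and lower: "\<And>x. m * (norm x)\<^sup>2 \<le> Re (cinner (blinfun_apply A x) x)"
    and upper: "\<And>x. Re (cinner (blinfun_apply A x) x) \<le> M * (norm x)\<^sup>2"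
  shows "op_spectrum A \<subseteq> complex_of_real ` {m..M}"
proof
  fix z assume z: "z \<in> op_spectrum A"
  define r where "r = Re z"
  have zr: "z = complex_of_real r" using spectrum_real[OF A z] by (simp add: r_def)
  define T where "T = opoly A [:- z, 1:]"
  have T: "Re (cinner (blinfun_apply T x) x) = Re (cinner (blinfun_apply A x) x) - r * (norm x)\<^sup>2" for x
    by (simp add: T_def zr opoly_linear_apply cinner_diff_left cinner_scaleC_left cinner_self
        flip: of_real_power)
  have not_bb: "\<not> bounded_below T"
    using z not_in_spectrum_iff[OF A] unfolding T_def by blast
  have bb: "bounded_below T" if c: "c > 0" and "\<And>x. c * (norm x)\<^sup>2 \<le> \<bar>Re (cinner (blinfun_apply T x) x)\<bar>" for c
    unfolding bounded_below_def
  proof (intro exI[of _ c] conjI allI c)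
    fix x
    show "c * norm x \<le> norm (blinfun_apply T x)"
    proof (cases "x = 0")
      case False
      have "c * (norm x)\<^sup>2 \<le> norm (blinfun_apply T x) * norm x"
        using that(2)[of x] abs_Re_le_cmod[of "cinner (blinfun_apply T x) x"]
          cmod_cinner_le[of "blinfun_apply T x" x] by linarith
      then show ?thesis using False by (simp add: power2_eq_square)
    qed simp
  qed
  have "m \<le> r"
  proof (rule ccontr)
    assume "\<not> m \<le> r"
    moreover have "(m - r) * (norm x)\<^sup>2 \<le> \<bar>Re (cinner (blinfun_apply T x) x)\<bar>" for x
      using lower[of x] unfolding T left_diff_distrib by linarith
    ultimately show False using bb[of "m - r"] not_bb by simp
  qed
  moreover have "r \<le> M"
  proof (rule ccontr)
    assume "\<not> r \<le> M"
    moreover have "(r - M) * (norm x)\<^sup>2 \<le> \<bar>Re (cinner (blinfun_apply T x) x)\<bar>" for x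
      using upper[of x] unfolding T left_diff_distrib by linarith
    ultimately show False using bb[of "r - M"] not_bb by simp
  qed
  ultimately show "z \<in> complex_of_real ` {m..M}" using zr by auto
qed

text \<open>The numerical bound confines the spectrum to \<open>{- k..k}\<close>, and the isometry
  at the identity polynomial turns this into a norm bound.\<close>

lemma selfadjoint_norm_le:
  assumes A: "A \<in> selfadjoint_ops" and k: "k \<ge> 0"
    and bound: "\<And>x. \<bar>Re (cinner (blinfun_apply A x) x)\<bar> \<le> k * (norm x)\<^sup>2"
  shows "norm A \<le> k"
proof -
  have "op_spectrum A \<subseteq> complex_of_real ` {- k..k}"
    using bound by (intro spectrum_subset_if_bounds[OF A]) (auto simp: abs_le_iff minus_le_iff)
  then have "\<forall>z\<in>op_spectrum A. cmod (poly [:0, 1:] z) \<le> k" by fastforce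
  then show ?thesis
    using opoly_norm_le_iff[OF A k, of "[:0, 1:]"] by (simp add: opoly_X)
qed

text \<open>Spectra do not behave linearly along a segment, but quadratic forms do; the inclusion is
  translated into form bounds and back.\<close>

lemma spectrum_segment:
  assumes A: "A \<in> selfadjoint_ops" "op_spectrum A \<subseteq> complex_of_real ` {m..M}"
    and V: "A + D \<in> selfadjoint_ops" "op_spectrum (A + D) \<subseteq> complex_of_real ` {m..M}"
    and X: "A + s *\<^sub>R D \<in> selfadjoint_ops" and s: "s \<in> {0..1}"
  shows "op_spectrum (A + s *\<^sub>R D) \<subseteq> complex_of_real ` {m..M}"
proof (rule spectrum_subset_if_bounds[OF X])
  fix x
  have eq: "Re (cinner (blinfun_apply (A + s *\<^sub>R D) x) x) =
      (1 - s) * Re (cinner (blinfun_apply A x) x) + s * Re (cinner (blinfun_apply (A + D) x) x)"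
    by (simp add: blinfun.add_left blinfun.scaleR_left cinner_add_left cinner_scaleR_left algebra_simps)
  note bA = selfadjoint_bounds_if_spectrum[OF A, of x] and bV = selfadjoint_bounds_if_spectrum[OF V, of x]
  have "(1 - s) * (m * (norm x)\<^sup>2) + s * (m * (norm x)\<^sup>2) \<le> Re (cinner (blinfun_apply (A + s *\<^sub>R D) x) x)"
    unfolding eq using bA bV s by (intro add_mono mult_left_mono) auto
  then show "m * (norm x)\<^sup>2 \<le> Re (cinner (blinfun_apply (A + s *\<^sub>R D) x) x)"
    by (simp add: algebra_simps)
  have "Re (cinner (blinfun_apply (A + s *\<^sub>R D) x) x) \<le> (1 - s) * (M * (norm x)\<^sup>2) + s * (M * (norm x)\<^sup>2)"
    unfolding eq using bA bV s by (intro add_mono mult_left_mono) auto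
  then show "Re (cinner (blinfun_apply (A + s *\<^sub>R D) x) x) \<le> M * (norm x)\<^sup>2"
    by (simp add: algebra_simps)
qed

section \<open>Regularity of operator functions and of their integrals\<close>

lemma continuous_on_spectrum:
  assumes "continuous_on I f" "op_spectrum A \<subseteq> complex_of_real ` I"
  shows "continuous_on (op_spectrum A) (\<lambda>z. f (Re z))"
  by (rule continuous_on_compose2[OF assms(1)]) (use assms(2) in \<open>auto intro!: continuous_intros\<close>)

lemma op_fun_selfadjoint:
  assumes A: "A \<in> selfadjoint_ops" and f: "continuous_on I f" and spec: "op_spectrum A \<subseteq> complex_of_real ` I"
  shows "op_fun f A \<in> selfadjoint_ops"
  by (rule calculus_limit_selfadjoint[OF A calculus_limit_op_fun[OF A]])
    (intro continuous_on_of_real continuous_on_spectrum[OF f spec])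

lemma op_fun_nonneg:
  assumes A: "A \<in> selfadjoint_ops" and f: "continuous_on I f" and spec: "op_spectrum A \<subseteq> complex_of_real ` I"
    and nonneg: "\<And>t. t \<in> I \<Longrightarrow> 0 \<le> f t"
  shows "0 \<le> Re (cinner (blinfun_apply (op_fun f A) x) x)"
proof (rule calculus_limit_nonneg[OF A calculus_limit_op_fun[OF A]])
  show "continuous_on (op_spectrum A) (\<lambda>z. f (Re z))"
    by (rule continuous_on_spectrum[OF f spec])
  then show "continuous_on (op_spectrum A) (\<lambda>z. complex_of_real (f (Re z)))"
    by (rule continuous_on_of_real)
qed (use spec nonneg in auto)

lemma continuous_on_opoly:
  assumes "continuous_on J X"
  shows "continuous_on J (\<lambda>s. opoly (X s) p)"
proof (induction p)
  case (pCons a p)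
  then show ?case
    unfolding opoly_pCons using assms
    by (intro continuous_intros bounded_bilinear.continuous_on[OF bounded_bilinear_blinfun_compose])
qed simp

text \<open>One sequence of polynomials approximates \<open>f\<close> on the interval containing all
  the spectra. By the isometry the operators converge uniformly in \<open>s\<close>, and a uniform
  limit of continuous maps is continuous.\<close>

lemma continuous_on_op_fun:
  assumes X: "continuous_on J X" and sa: "\<And>s. s \<in> J \<Longrightarrow> X s \<in> selfadjoint_ops"
    and spec: "\<And>s. s \<in> J \<Longrightarrow> op_spectrum (X s) \<subseteq> complex_of_real ` {m..M}"
    and f: "continuous_on {m..M} f"
  shows "continuous_on J (\<lambda>s. op_fun f (X s))"
proof -
  let ?K = "complex_of_real ` {m..M}" and ?g = "\<lambda>z. complex_of_real (f (Re z))"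
  have K: "compact ?K" by (intro compact_continuous_image continuous_intros compact_Icc)
  have g: "continuous_on ?K ?g"
    by (intro continuous_on_of_real continuous_on_compose2[OF f]) (auto intro!: continuous_intros)
  have "\<exists>p. \<forall>z\<in>?K. cmod (poly p z - ?g z) < inverse (real (Suc n))" for n
  proof -
    obtain p where "\<And>z. z \<in> ?K \<Longrightarrow> cmod (poly p z - ?g z) < inverse (real (Suc n))"
      by (rule Weierstrass_complex_poly[OF K _ g, of "inverse (real (Suc n))"]) auto
    then show ?thesis by (intro exI[of _ p] ballI)
  qed
  then obtain P where P: "\<And>n z. z \<in> ?K \<Longrightarrow> cmod (poly (P n) z - ?g z) < inverse (real (Suc n))"
    using choice[of "\<lambda>n p. \<forall>z\<in>?K. cmod (poly p z - ?g z) < inverse (real (Suc n))"] by blast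
  have close: "norm (opoly (X s) (P n) - op_fun f (X s)) \<le> inverse (real (Suc n))" if s: "s \<in> J" for s n
  proof -
    have "continuous_on (op_spectrum (X s)) ?g" using g spec[OF s] by (rule continuous_on_subset)
    then have "calculus_limit (X s) (\<lambda>z. poly (P n) z - ?g z) (opoly (X s) (P n) - op_fun f (X s))"
      using sa[OF s] by (intro calculus_limit_diff calculus_limit_poly calculus_limit_op_fun)
    then show ?thesis
      using P spec[OF s] calculus_limit_norm_le_iff[OF sa[OF s], of _ _ "inverse (real (Suc n))"]
      by (meson inverse_nonnegative_iff_nonnegative of_nat_0_le_iff less_imp_le subsetD)
  qed
  show ?thesis
  proof (rule uniform_limit_theorem)
    show "\<forall>\<^sub>F n in sequentially. continuous_on J (\<lambda>s. opoly (X s) (P n))"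
      by (simp add: continuous_on_opoly[OF X])
    show "uniform_limit J (\<lambda>n s. opoly (X s) (P n)) (\<lambda>s. op_fun f (X s)) sequentially"
    proof (rule uniform_limitI)
      fix e :: real assume "e > 0"
      then have "\<forall>\<^sub>F n in sequentially. inverse (real (Suc n)) < e"
        using LIMSEQ_inverse_real_of_nat order_tendstoD(2) by blast
      then show "\<forall>\<^sub>F n in sequentially. \<forall>s\<in>J. dist (opoly (X s) (P n)) (op_fun f (X s)) < e"
        by eventually_elim (use close in \<open>auto simp: dist_norm intro: order_le_less_trans\<close>)
    qed
  qed simp
qed

text \<open>Complex linearity and selfadjointness are equations between bounded real-linear maps of
  the operator, and such maps commute with the integral.\<close>

lemma integral_selfadjoint:
  fixes F :: "real \<Rightarrow> ('a::complex_hilbert_space \<Rightarrow>\<^sub>L 'a)"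
  assumes F: "F integrable_on S" and sa: "\<And>s. s \<in> S \<Longrightarrow> F s \<in> selfadjoint_ops"
  shows "integral S F \<in> selfadjoint_ops"
proof -
  have eq: "h (integral S F) = k (integral S F)"
    if "bounded_linear h" "bounded_linear k" "\<And>s. s \<in> S \<Longrightarrow> h (F s) = k (F s)"
    for h k :: "('a \<Rightarrow>\<^sub>L 'a) \<Rightarrow> 'b::banach"
    using integral_linear[OF F that(1)] integral_linear[OF F that(2)] that(3)
      integral_cong[of S "h \<circ> F" "k \<circ> F"] by simp
  have app: "bounded_linear (\<lambda>T. blinfun_apply T (x::'a))" for x
    by (rule blinfun.bounded_linear_left)
  have "blinfun_apply (integral S F) (c *\<^sub>C x) = c *\<^sub>C blinfun_apply (integral S F) x" for c x
    by (rule eq) (use sa in \<open>auto intro!: app selfadjointD(1)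
        bounded_linear_compose[OF bounded_bilinear.bounded_linear_right[OF bounded_bilinear_scaleC] app]\<close>)
  moreover have "cinner (blinfun_apply (integral S F) x) y = cinner x (blinfun_apply (integral S F) y)" for x y
    by (rule eq) (use sa in \<open>auto intro!: selfadjointD(2)
        bounded_linear_compose[OF bounded_bilinear.bounded_linear_right[OF bounded_bilinear_cinner] app]
        bounded_linear_compose[OF bounded_bilinear.bounded_linear_left[OF bounded_bilinear_cinner] app]\<close>)
  ultimately show ?thesis
    by (simp add: selfadjoint_ops_def bounded_ops_def is_adjoint_def)
qed

section \<open>The trapezoid error for scalars and for operators\<close>

text \<open>The integral is split at the midpoint, where the absolute value changes branch; the
  \<open>\<beta>\<close> term is odd about it and cancels.\<close>

lemma has_integral_abs_linear:
  fixes a b \<alpha> \<beta> :: real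
  assumes "a \<le> b"
  defines "c \<equiv> (a + b) / 2"
  shows "((\<lambda>t. \<bar>t - c\<bar> * (\<alpha> + \<beta> * (t - c))) has_integral \<alpha> * (b - a)\<^sup>2 / 4) {a..b}"
proof -
  define F where "F t = \<alpha> * (t - c)\<^sup>2 / 2 + \<beta> * (t - c)^3 / 3" for t
  have c: "a \<le> c" "c \<le> b" using assms by (auto simp: c_def)
  have F: "(F has_vector_derivative (t - c) * (\<alpha> + \<beta> * (t - c))) (at t within S)" for t S
    unfolding F_def has_real_derivative_iff_has_vector_derivative[symmetric]
    by (auto intro!: derivative_eq_intros simp: field_simps power2_eq_square)
  have "((\<lambda>t. - ((t - c) * (\<alpha> + \<beta> * (t - c)))) has_integral - (F c - F a)) {a..c}"
    by (intro has_integral_neg fundamental_theorem_of_calculus c F)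
  then have 1: "((\<lambda>t. \<bar>t - c\<bar> * (\<alpha> + \<beta> * (t - c))) has_integral - (F c - F a)) {a..c}"
    by (rule has_integral_eq[rotated]) (simp add: algebra_simps)
  have "((\<lambda>t. (t - c) * (\<alpha> + \<beta> * (t - c))) has_integral F b - F c) {c..b}"
    by (intro fundamental_theorem_of_calculus c F)
  then have 2: "((\<lambda>t. \<bar>t - c\<bar> * (\<alpha> + \<beta> * (t - c))) has_integral F b - F c) {c..b}"
    by (rule has_integral_eq[rotated]) auto
  have "a - c = - ((b - a) / 2)" "b - c = (b - a) / 2"
    by (simp_all add: c_def field_simps)
  then have "- (F c - F a) + (F b - F c) = \<alpha> * (b - a)\<^sup>2 / 4"
    unfolding F_def by (simp only:) (simp add: power2_eq_square power3_eq_cube)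
  then show ?thesis
    using has_integral_combine[OF c 1 2] by (simp only:)
qed

text \<open>The assumption \<open>convex\<close> compares \<open>g\<close> with its chord over
  \<open>{a..b}\<close> only, which is all that the weighted integral of the error requires.\<close>

lemma trapezoid_convex_bound:
  fixes g :: "real \<Rightarrow> real"
  assumes a: "0 \<le> a" "a < b" and g: "continuous_on {0..b} g"
    and nonneg: "\<And>t. t \<in> {a..b} \<Longrightarrow> 0 \<le> g t"
    and convex: "\<And>t. t \<in> {0..1} \<Longrightarrow> g (b + t * (a - b)) \<le> (1 - t) * g b + t * g a"
  defines "G \<equiv> \<lambda>t. integral {0..t} g"
  shows "\<bar>G a / 2 + G b / 2 - integral {a..b} G / (b - a)\<bar> \<le> (b - a) / 8 * (g a + g b)"
proof -
  define c where "c = (a + b) / 2"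
  \<comment> \<open>\<open>\<alpha>\<close> is the height of the chord at the midpoint and
    \<open>\<beta>\<close> its slope.\<close>
  define \<alpha> where "\<alpha> = (g a + g b) / 2"
  define \<beta> where "\<beta> = (g b - g a) / (b - a)"
  have dG: "(G has_real_derivative g t) (at t within {a..b})" if "t \<in> {a..b}" for t
    unfolding G_def
    by (rule DERIV_subset[OF integral_has_real_derivative[OF g]]) (use that a in auto)
  have contG: "continuous_on {a..b} G"
    using dG by (meson DERIV_continuous_on)
  have gab: "continuous_on {a..b} g"
    by (rule continuous_on_subset[OF g]) (use a in auto)
  \<comment> \<open>The integrand is the derivative of \<open>(t - c) * G t\<close>. At the end
    points \<open>t - c\<close> is plus or minus half the length, which produces the trapezoid
    weights.\<close>
  have "((\<lambda>t. G t + (t - c) * g t) has_integral (b - c) * G b - (a - c) * G a) {a..b}"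
    using a(2)
    by (intro fundamental_theorem_of_calculus)
      (auto simp: has_real_derivative_iff_has_vector_derivative[symmetric]
        intro!: derivative_eq_intros dG)
  moreover have intg: "(\<lambda>t. (t - c) * g t) integrable_on {a..b}"
    by (intro integrable_continuous_real continuous_intros gab)
  ultimately have parts: "integral {a..b} G + integral {a..b} (\<lambda>t. (t - c) * g t) = (b - c) * G b - (a - c) * G a"
    using integral_add[OF integrable_continuous_real[OF contG] intg] by (simp add: integral_unique)
  have boundary: "(b - c) * G b - (a - c) * G a = (b - a) * (G a / 2 + G b / 2)"
    by (simp add: c_def field_simps)
  have err: "G a / 2 + G b / 2 - integral {a..b} G / (b - a) =
      integral {a..b} (\<lambda>t. (t - c) * g t) / (b - a)"
  proof -
    have "G a / 2 + G b / 2 - integral {a..b} G / (b - a) =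
        ((b - a) * (G a / 2 + G b / 2) - integral {a..b} G) / (b - a)"
      using a(2) by (simp add: diff_divide_distrib)
    also have "(b - a) * (G a / 2 + G b / 2) - integral {a..b} G = integral {a..b} (\<lambda>t. (t - c) * g t)"
      unfolding boundary[symmetric] using parts by simp
    finally show ?thesis .
  qed
  have chord: "g t \<le> \<alpha> + \<beta> * (t - c)" if t: "t \<in> {a..b}" for t
  proof -
    \<comment> \<open>The assumption travels from \<open>b\<close> back to \<open>a\<close>;
      \<open>u\<close> is the parameter at which it passes \<open>t\<close>.\<close>
    define u where "u = (b - t) / (b - a)"
    have u: "u \<in> {0..1}" "b + u * (a - b) = t"
      using t a(2) by (auto simp: u_def field_simps)
    have "(1 - u) * g b + u * g a = \<alpha> + \<beta> * (t - c)"
      using a(2) unfolding u_def \<alpha>_def \<beta>_def c_def by (simp add: divide_simps) algebra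
    then show ?thesis using convex[OF u(1)] u(2) by simp
  qed
  have bound: "((\<lambda>t. \<bar>t - c\<bar> * (\<alpha> + \<beta> * (t - c))) has_integral \<alpha> * (b - a)\<^sup>2 / 4) {a..b}"
    unfolding c_def by (rule has_integral_abs_linear) (use a in simp)
  \<comment> \<open>Nonnegativity of \<open>g\<close> makes the modulus of the integrand
    \<open>\<bar>t - c\<bar> * g t\<close>, where the chord may replace \<open>g\<close>.\<close>
  have "norm (integral {a..b} (\<lambda>t. (t - c) * g t)) \<le> integral {a..b} (\<lambda>t. \<bar>t - c\<bar> * (\<alpha> + \<beta> * (t - c)))"
    using bound chord nonneg
    by (intro integral_norm_bound_integral intg) (auto simp: abs_mult intro!: mult_left_mono)
  then have "\<bar>integral {a..b} (\<lambda>t. (t - c) * g t)\<bar> / (b - a) \<le> \<alpha> * (b - a)\<^sup>2 / 4 / (b - a)"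
    using bound a(2) by (intro divide_right_mono) (auto simp: integral_unique)
  also have "\<dots> = (b - a) / 8 * (g a + g b)"
  proof -
    have "\<alpha> * d\<^sup>2 / 4 / d = d / 8 * (g a + g b)" if "d \<noteq> 0" for d
      using that by (simp add: \<alpha>_def power2_eq_square)
    from this[of "b - a"] show ?thesis using a(2) by (metis less_irrefl right_minus_eq)
  qed
  finally show ?thesis
    unfolding err using a(2) by (simp add: abs_divide)
qed

text \<open>For each \<open>x\<close> the scalar inequality applies to the quadratic form
  \<open>g x\<close>. Holding for all \<open>x\<close>, it also bounds the numerical radius of the
  selfadjoint error operator \<open>E\<close>, hence its norm.\<close>

lemma trapezoid_operator_bound:
  fixes \<phi> :: "real \<Rightarrow> ('a::complex_hilbert_space \<Rightarrow>\<^sub>L 'a)"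
  assumes a: "0 \<le> a" "a < b" and \<phi>: "continuous_on {0..b} \<phi>"
    and sa: "\<And>s. s \<in> {0..b} \<Longrightarrow> \<phi> s \<in> selfadjoint_ops"
    and nonneg: "\<And>s x. s \<in> {a..b} \<Longrightarrow> 0 \<le> Re (cinner (blinfun_apply (\<phi> s) x) x)"
    and convex: "\<And>t. t \<in> {0..1} \<Longrightarrow> op_le (\<phi> (b + t * (a - b))) ((1 - t) *\<^sub>R \<phi> b + t *\<^sub>R \<phi> a)"
  shows "cmod (1/2 * cinner (blinfun_apply (integral {0..a} \<phi>) x) x
            + 1/2 * cinner (blinfun_apply (integral {0..b} \<phi>) x) x
            - 1 / complex_of_real (b - a) *
                integral {a..b} (\<lambda>t. cinner (blinfun_apply (integral {0..t} \<phi>) x) x))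
        \<le> (b - a) / 8 * (Re (cinner (blinfun_apply (\<phi> a) x) x) + Re (cinner (blinfun_apply (\<phi> b) x) x))"
    and "norm ((1/2) *\<^sub>R integral {0..a} \<phi> + (1/2) *\<^sub>R integral {0..b} \<phi>
            - (1 / (b - a)) *\<^sub>R integral {a..b} (\<lambda>t. integral {0..t} \<phi>))
        \<le> (b - a) / 8 * norm (\<phi> a + \<phi> b)"
proof -
  define g where "g x s = Re (cinner (blinfun_apply (\<phi> s) x) x)" for x s
  define G where "G x t = integral {0..t} (g x)" for x t
  \<comment> \<open>For fixed \<open>x\<close> this is bounded and real-linear in \<open>T\<close>,
    so it can be moved under both integrals.\<close>
  define q where "q x T = cinner (blinfun_apply T x) x" for x :: 'a and T
  have q: "bounded_linear (q x)" for x
    unfolding q_def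
    by (rule bounded_linear_compose[OF bounded_bilinear.bounded_linear_left[OF bounded_bilinear_cinner]
          blinfun.bounded_linear_left])
  have q_int: "q x (integral S F) = integral S (\<lambda>s. q x (F s))" if "F integrable_on S" for x S F
    using integral_linear[OF that q] by (simp add: o_def)
  have of_real_int: "integral S (\<lambda>s. complex_of_real (F s)) = complex_of_real (integral S F)"
    if "F integrable_on S" for S :: "real set" and F :: "real \<Rightarrow> real"
    using integral_linear[OF that bounded_linear_of_real] by (simp add: o_def)
  have q\<phi>: "q x (\<phi> s) = complex_of_real (g x s)" if "s \<in> {0..b}" for x s
    unfolding q_def g_def by (rule cinner_selfadjoint_real[OF sa[OF that]])
  have cont_g: "continuous_on {0..b} (g x)" for x
    unfolding g_def
    by (intro continuous_on_Re bounded_bilinear.continuous_on[OF bounded_bilinear_cinner]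
        bounded_bilinear.continuous_on[OF bounded_bilinear_blinfun_apply] continuous_on_const \<phi>)
  have int_\<phi>: "\<phi> integrable_on {0..t}" and int_g: "g x integrable_on {0..t}" if "t \<in> {0..b}" for x t
    using that by (auto intro!: integrable_continuous_real continuous_on_subset[OF \<phi>]
        continuous_on_subset[OF cont_g])
  have qG: "q x (integral {0..t} \<phi>) = complex_of_real (G x t)" if t: "t \<in> {0..b}" for x t
  proof -
    have "q x (integral {0..t} \<phi>) = integral {0..t} (\<lambda>s. complex_of_real (g x s))"
      unfolding q_int[OF int_\<phi>[OF t]] using t by (intro integral_cong q\<phi>) auto
    then show ?thesis by (simp add: of_real_int int_g[OF t] G_def)
  qed
  have cont_int: "continuous_on {a..b} (\<lambda>t. integral {0..t} \<phi>)"
  proof -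
    have "\<phi> integrable_on {0..b}" by (rule int_\<phi>) (use a in simp)
    then show ?thesis
      by (rule continuous_on_subset[OF indefinite_integral_continuous_1]) (use a in auto)
  qed
  have cont_G: "continuous_on {a..b} (G x)" for x
  proof -
    have "g x integrable_on {0..b}" by (rule int_g) (use a in simp)
    then show ?thesis
      unfolding G_def
      by (rule continuous_on_subset[OF indefinite_integral_continuous_1]) (use a in auto)
  qed
  have qGG: "integral {a..b} (\<lambda>t. q x (integral {0..t} \<phi>)) = complex_of_real (integral {a..b} (G x))" for x
  proof -
    have "integral {a..b} (\<lambda>t. q x (integral {0..t} \<phi>)) = integral {a..b} (\<lambda>t. complex_of_real (G x t))"
      using a by (intro integral_cong qG) auto
    then show ?thesis by (simp add: of_real_int integrable_continuous_real[OF cont_G])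
  qed
  have scalar: "\<bar>G x a / 2 + G x b / 2 - integral {a..b} (G x) / (b - a)\<bar> \<le> (b - a) / 8 * (g x a + g x b)" for x
    unfolding G_def
  proof (rule trapezoid_convex_bound[OF a cont_g])
    show "0 \<le> g x t" if "t \<in> {a..b}" for t using nonneg[OF that] by (simp add: g_def)
    show "g x (b + t * (a - b)) \<le> (1 - t) * g x b + t * g x a" if "t \<in> {0..1}" for t
      using convex[OF that] unfolding op_le_def g_def
      by (simp add: blinfun.add_left blinfun.scaleR_left cinner_add_left cinner_scaleR_left)
  qed
  have "cmod (1/2 * q x (integral {0..a} \<phi>) + 1/2 * q x (integral {0..b} \<phi>)
            - 1 / complex_of_real (b - a) * integral {a..b} (\<lambda>t. q x (integral {0..t} \<phi>)))
      = cmod (complex_of_real (G x a / 2 + G x b / 2 - integral {a..b} (G x) / (b - a)))" for x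
    unfolding qGG using a by (subst (1 2) qG) auto
  then have "cmod (1/2 * q x (integral {0..a} \<phi>) + 1/2 * q x (integral {0..b} \<phi>)
            - 1 / complex_of_real (b - a) * integral {a..b} (\<lambda>t. q x (integral {0..t} \<phi>)))
      \<le> (b - a) / 8 * (g x a + g x b)" for x
    using scalar[of x] by (simp only: norm_of_real)
  then show "cmod (1/2 * cinner (blinfun_apply (integral {0..a} \<phi>) x) x
            + 1/2 * cinner (blinfun_apply (integral {0..b} \<phi>) x) x
            - 1 / complex_of_real (b - a) *
                integral {a..b} (\<lambda>t. cinner (blinfun_apply (integral {0..t} \<phi>) x) x))
        \<le> (b - a) / 8 * (Re (cinner (blinfun_apply (\<phi> a) x) x) + Re (cinner (blinfun_apply (\<phi> b) x) x))"
    unfolding q_def g_def .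
  define E where "E = (1/2) *\<^sub>R integral {0..a} \<phi> + (1/2) *\<^sub>R integral {0..b} \<phi>
            - (1 / (b - a)) *\<^sub>R integral {a..b} (\<lambda>t. integral {0..t} \<phi>)"
  have int_sa: "integral {0..t} \<phi> \<in> selfadjoint_ops" if "t \<in> {0..b}" for t
    using that by (intro integral_selfadjoint int_\<phi> sa) auto
  have "integral {a..b} (\<lambda>t. integral {0..t} \<phi>) \<in> selfadjoint_ops"
    using a by (intro integral_selfadjoint integrable_continuous_real cont_int int_sa) auto
  then have E_sa: "E \<in> selfadjoint_ops"
    using a unfolding E_def diff_conv_add_uminus scaleR_minus_left[symmetric]
    by (intro selfadjoint_ops_add selfadjoint_ops_scaleR int_sa) auto
  have qE: "q x E = complex_of_real (G x a / 2 + G x b / 2 - integral {a..b} (G x) / (b - a))" for x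
  proof -
    interpret bounded_linear "q x" by (rule q)
    show ?thesis
      using a
      by (simp add: E_def add diff scaleR qG qGG q_int integrable_continuous_real[OF cont_int]
          scaleR_conv_of_real)
  qed
  have "norm E \<le> (b - a) / 8 * norm (\<phi> a + \<phi> b)"
  proof (rule selfadjoint_norm_le[OF E_sa])
    show "0 \<le> (b - a) / 8 * norm (\<phi> a + \<phi> b)" using a by simp
    fix x
    have "\<bar>Re (cinner (blinfun_apply E x) x)\<bar> \<le> (b - a) / 8 * (g x a + g x b)"
      using scalar[of x] qE[of x] by (simp add: q_def)
    also have "g x a + g x b = Re (cinner (blinfun_apply (\<phi> a + \<phi> b) x) x)"
      by (simp add: g_def blinfun.add_left cinner_add_left)
    also have "\<dots> \<le> norm (blinfun_apply (\<phi> a + \<phi> b) x) * norm x"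
      using complex_Re_le_cmod cmod_cinner_le by (rule order_trans)
    also have "\<dots> \<le> norm (\<phi> a + \<phi> b) * norm x * norm x"
      by (intro mult_right_mono norm_blinfun) simp
    finally show "\<bar>Re (cinner (blinfun_apply E x) x)\<bar> \<le> (b - a) / 8 * norm (\<phi> a + \<phi> b) * (norm x)\<^sup>2"
      using a by (simp add: power2_eq_square mult_ac)
  qed
  then show "norm ((1/2) *\<^sub>R integral {0..a} \<phi> + (1/2) *\<^sub>R integral {0..b} \<phi>
            - (1 / (b - a)) *\<^sub>R integral {a..b} (\<lambda>t. integral {0..t} \<phi>))
        \<le> (b - a) / 8 * norm (\<phi> a + \<phi> b)"
    unfolding E_def .
qed

section \<open>The eta-path and the conclusion\<close>

text \<open>\<open>I\<close> need not be compact, but uniform polynomial approximation asks for a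
  compact interval. The extreme points of the two compact spectra span one; the nonzero vector
  ensures that extreme points exist.\<close>

lemma common_spectral_interval:
  fixes A V :: "'a::complex_hilbert_space \<Rightarrow>\<^sub>L 'a"
  assumes A: "A \<in> selfadjoint_ops" "op_spectrum A \<subseteq> complex_of_real ` I"
    and V: "V \<in> selfadjoint_ops" "op_spectrum V \<subseteq> complex_of_real ` I"
    and x: "(x::'a) \<noteq> 0" and I: "is_interval I"
  obtains m M where "{m..M} \<subseteq> I" "op_spectrum A \<subseteq> complex_of_real ` {m..M}"
    "op_spectrum V \<subseteq> complex_of_real ` {m..M}"
proof -
  let ?K = "Re ` (op_spectrum A \<union> op_spectrum V)"
  have K: "compact ?K"
    by (intro compact_continuous_image compact_Un compact_spectrum A V continuous_intros)
  have ne: "?K \<noteq> {}" using spectrum_nonempty[OF A(1) x] by auto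
  have KI: "?K \<subseteq> I" using A(2) V(2) by auto
  obtain m where m: "m \<in> ?K" "\<And>t. t \<in> ?K \<Longrightarrow> m \<le> t"
    using compact_attains_inf[OF K ne] by blast
  obtain M where M: "M \<in> ?K" "\<And>t. t \<in> ?K \<Longrightarrow> t \<le> M"
    using compact_attains_sup[OF K ne] by blast
  have "z \<in> complex_of_real ` {m..M}" if "z \<in> op_spectrum A \<union> op_spectrum V" for z
  proof (rule image_eqI)
    show "z = complex_of_real (Re z)" using that A(2) V(2) by auto
    show "Re z \<in> {m..M}" using that m(2) M(2) by auto
  qed
  then have "op_spectrum A \<subseteq> complex_of_real ` {m..M}" "op_spectrum V \<subseteq> complex_of_real ` {m..M}"
    by (simp_all add: subset_iff)
  moreover have "{m..M} \<subseteq> I"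
  proof
    fix t assume "t \<in> {m..M}"
    then show "t \<in> I"
      using mem_is_interval_1_I[OF I, of m M t] m(1) M(1) KI by (simp only: atLeastAtMost_iff subset_iff)
  qed
  ultimately show ?thesis by (intro that)
qed

text \<open>The second clause of condition (C) gives \<open>(1 - a) *\<^sub>R D\<close> as the
  direction from the point at \<open>a\<close> towards \<open>B\<close>. The point at
  \<open>b\<close> is reached from there at parameter \<open>\<tau>\<close>, so the first clause,
  based at the point at \<open>a\<close>, gives the claim.\<close>

lemma condition_C_path:
  assumes C: "condition_C S \<eta>" and S: "invex_set S \<eta>" and AB: "A \<in> S" "B \<in> S"
    and a: "0 \<le> a" "a < 1" and b: "a \<le> b" "b \<le> 1"
  shows "\<eta> (A + a *\<^sub>R \<eta> B A) (A + b *\<^sub>R \<eta> B A) = (a - b) *\<^sub>R \<eta> B A"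
proof -
  define D where "D = \<eta> B A"
  define \<tau> where "\<tau> = (b - a) / (1 - a)"
  have \<tau>: "\<tau> \<in> {0..1}" "\<tau> * (1 - a) = b - a" using a b by (auto simp: \<tau>_def field_simps)
  have Xa: "A + a *\<^sub>R D \<in> S" using S AB a b by (simp add: invex_set_def D_def)
  have \<eta>B: "\<eta> B (A + a *\<^sub>R D) = (1 - a) *\<^sub>R D" using C AB a b by (simp add: condition_C_def D_def)
  have "\<eta> (A + a *\<^sub>R D) ((A + a *\<^sub>R D) + \<tau> *\<^sub>R \<eta> B (A + a *\<^sub>R D)) = - (\<tau> *\<^sub>R \<eta> B (A + a *\<^sub>R D))"
    using C AB(2) Xa \<tau>(1) unfolding condition_C_def by blast
  then have "\<eta> (A + a *\<^sub>R D) (A + (a + (b - a)) *\<^sub>R D) = - ((b - a) *\<^sub>R D)"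
    by (simp only: \<eta>B scaleR_scaleR \<tau>(2) add.assoc scaleR_add_left)
  then show ?thesis by (simp add: D_def scaleR_minus_left[symmetric] del: scaleR_minus_left)
qed

theorem theorem3p6:
  fixes I :: "real set"
    and f :: "real \<Rightarrow> real"
    and S :: "('a::complex_hilbert_space \<Rightarrow>\<^sub>L 'a) set"
    and \<eta> :: "('a \<Rightarrow>\<^sub>L 'a) \<Rightarrow> ('a \<Rightarrow>\<^sub>L 'a) \<Rightarrow> ('a \<Rightarrow>\<^sub>L 'a)"
  assumes "is_interval I"
    and "continuous_on I f"
    and "\<forall>t\<in>I. 0 \<le> f t"
    and "openin (top_of_set selfadjoint_ops) S"
    and "\<forall>X\<in>S. \<forall>Y\<in>S. \<eta> X Y \<in> selfadjoint_ops"
    and "invex_set S \<eta>"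
    and "condition_C S \<eta>"
    and "\<forall>A\<in>S. \<forall>B\<in>S. spectrum_in A I \<longrightarrow> spectrum_in (A + \<eta> B A) I \<longrightarrow>
           operator_preinvex I \<eta> (eta_path \<eta> A B) f"
  shows "\<forall>A\<in>S. \<forall>B\<in>S. spectrum_in A I \<longrightarrow> spectrum_in (A + \<eta> B A) I \<longrightarrow>
    (\<forall>a\<in>{0<..<1}. \<forall>b\<in>{0<..<1}. a < b \<longrightarrow>
      (\<forall>x. norm x = 1 \<longrightarrow>
        cmod (1/2 * cinner (blinfun_apply (integral {0..a} (\<lambda>s. op_fun f (A + s *\<^sub>R \<eta> B A))) x) x
            + 1/2 * cinner (blinfun_apply (integral {0..b} (\<lambda>s. op_fun f (A + s *\<^sub>R \<eta> B A))) x) x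
            - 1 / complex_of_real (b - a) *
                integral {a..b} (\<lambda>t.
                  cinner (blinfun_apply (integral {0..t} (\<lambda>s. op_fun f (A + s *\<^sub>R \<eta> B A))) x) x))
        \<le> (b - a) / 8 *
            (Re (cinner (blinfun_apply (op_fun f (A + a *\<^sub>R \<eta> B A)) x) x)
           + Re (cinner (blinfun_apply (op_fun f (A + b *\<^sub>R \<eta> B A)) x) x)))
      \<and> norm ((1/2) *\<^sub>R integral {0..a} (\<lambda>s. op_fun f (A + s *\<^sub>R \<eta> B A))
            + (1/2) *\<^sub>R integral {0..b} (\<lambda>s. op_fun f (A + s *\<^sub>R \<eta> B A))
            - (1 / (b - a)) *\<^sub>R
                integral {a..b} (\<lambda>t. integral {0..t} (\<lambda>s. op_fun f (A + s *\<^sub>R \<eta> B A))))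
        \<le> (b - a) / 8 *
            norm (op_fun f (A + a *\<^sub>R \<eta> B A) + op_fun f (A + b *\<^sub>R \<eta> B A))
      \<and> (b - a) / 8 *
            norm (op_fun f (A + a *\<^sub>R \<eta> B A) + op_fun f (A + b *\<^sub>R \<eta> B A))
        \<le> (b - a) / 8 *
            (norm (op_fun f (A + a *\<^sub>R \<eta> B A)) + norm (op_fun f (A + b *\<^sub>R \<eta> B A))))"
proof (intro ballI impI, goal_cases)
  case (1 A B a b)
  define D where "D = \<eta> B A"
  define X where "X s = A + s *\<^sub>R D" for s :: real
  define \<phi> where "\<phi> s = op_fun f (X s)" for s
  note AB = \<open>A \<in> S\<close> \<open>B \<in> S\<close>
  have ab: "0 < a" "a < b" "b < 1" using 1 by auto
  have X_S: "X s \<in> S" if "s \<in> {0..1}" for s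
    using assms(6) AB that by (simp add: invex_set_def X_def D_def)
  have sa: "X s \<in> selfadjoint_ops" if "s \<in> {0..1}" for s
    using X_S[OF that] openin_imp_subset[OF assms(4)] by blast
  have preinvex: "operator_preinvex I \<eta> (eta_path \<eta> A B) f"
    using assms(8) 1 by blast
  have X_path: "X s \<in> eta_path \<eta> A B" if "s \<in> {0..1}" for s
    using that by (auto simp: eta_path_def X_def D_def)
  have main:
    "(norm x = 1 \<longrightarrow>
        cmod (1/2 * cinner (blinfun_apply (integral {0..a} \<phi>) x) x
            + 1/2 * cinner (blinfun_apply (integral {0..b} \<phi>) x) x
            - 1 / complex_of_real (b - a) *
                integral {a..b} (\<lambda>t. cinner (blinfun_apply (integral {0..t} \<phi>) x) x))
        \<le> (b - a) / 8 * (Re (cinner (blinfun_apply (\<phi> a) x) x) + Re (cinner (blinfun_apply (\<phi> b) x) x)))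
      \<and> norm ((1/2) *\<^sub>R integral {0..a} \<phi> + (1/2) *\<^sub>R integral {0..b} \<phi>
            - (1 / (b - a)) *\<^sub>R integral {a..b} (\<lambda>t. integral {0..t} \<phi>))
        \<le> (b - a) / 8 * norm (\<phi> a + \<phi> b)" for x
  \<comment> \<open>On the trivial space the spectra are empty and span no interval, but there are
    no unit vectors and all operator norms vanish.\<close>
  proof (cases "\<forall>y::'a. y = 0")
    case True
    have "T = 0" for T :: "'a \<Rightarrow>\<^sub>L 'a"
      using True by (intro blinfun_eqI) metis
    then have norm0: "norm T = 0" for T :: "'a \<Rightarrow>\<^sub>L 'a" by simp
    have "norm x \<noteq> 1" using spec[OF True, of x] by simp
    then show ?thesis unfolding norm0 by simp
  next
    case False
    then obtain y :: 'a where y: "y \<noteq> 0" by blast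
    have A: "A \<in> selfadjoint_ops" "op_spectrum A \<subseteq> complex_of_real ` I"
      and V: "A + D \<in> selfadjoint_ops" "op_spectrum (A + D) \<subseteq> complex_of_real ` I"
      using sa[of 0] sa[of 1] 1 by (simp_all add: X_def D_def spectrum_in_def)
    obtain m M where mM: "{m..M} \<subseteq> I" "op_spectrum A \<subseteq> complex_of_real ` {m..M}"
      "op_spectrum (A + D) \<subseteq> complex_of_real ` {m..M}"
      by (rule common_spectral_interval[OF A V y assms(1)])
    have spec: "op_spectrum (X s) \<subseteq> complex_of_real ` {m..M}" if "s \<in> {0..1}" for s
      using spectrum_segment[OF A(1) mM(2) V(1) mM(3)] sa[OF that] that by (simp add: X_def)
    then have spec_I: "spectrum_in (X s) I" if "s \<in> {0..1}" for s
      using mM(1) that unfolding spectrum_in_def by blast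
    have f: "continuous_on {m..M} f" using assms(2) mM(1) by (rule continuous_on_subset)
    have cont_X: "continuous_on {0..b} X" unfolding X_def by (intro continuous_intros)
    have cont: "continuous_on {0..b} \<phi>"
      unfolding \<phi>_def by (rule continuous_on_op_fun[OF cont_X sa spec f]) (use ab in auto)
    have sa_\<phi>: "\<phi> s \<in> selfadjoint_ops" if "s \<in> {0..b}" for s
      unfolding \<phi>_def using that ab by (intro op_fun_selfadjoint[OF sa f spec]) auto
    have nonneg: "0 \<le> Re (cinner (blinfun_apply (\<phi> s) u) u)" if "s \<in> {a..b}" for s u
      unfolding \<phi>_def using that ab mM(1) assms(3) by (intro op_fun_nonneg[OF sa f spec]) auto
    have convex: "op_le (\<phi> (b + t * (a - b))) ((1 - t) *\<^sub>R \<phi> b + t *\<^sub>R \<phi> a)" if t: "t \<in> {0..1}" for t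
    proof -
      have "\<eta> (X a) (X b) = (a - b) *\<^sub>R D"
        unfolding X_def D_def using ab by (intro condition_C_path[OF assms(7,6) AB]) auto
      then have "X b + t *\<^sub>R \<eta> (X a) (X b) = X (b + t * (a - b))"
        by (simp add: X_def scaleR_add_left)
      \<comment> \<open>Preinvexity is applied with base point \<open>X b\<close> and target
        \<open>X a\<close>, the order in which condition (C) supplies the direction.\<close>
      moreover have "op_le (op_fun f (X b + t *\<^sub>R \<eta> (X a) (X b))) ((1 - t) *\<^sub>R op_fun f (X b) + t *\<^sub>R op_fun f (X a))"
        using preinvex X_path[of a] X_path[of b] spec_I[of a] spec_I[of b] ab t
        unfolding operator_preinvex_def by simp
      ultimately show ?thesis by (simp add: \<phi>_def)
    qed
    show ?thesis
      using trapezoid_operator_bound[OF less_imp_le[OF ab(1)] ab(2) cont sa_\<phi> nonneg convex] by blast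
  qed
  have "(b - a) / 8 * norm (\<phi> a + \<phi> b) \<le> (b - a) / 8 * (norm (\<phi> a) + norm (\<phi> b))"
    using ab by (intro mult_left_mono norm_triangle_ineq) auto
  with main show ?case
    unfolding \<phi>_def X_def D_def by blast
qed

end
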